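(* Let $\Sigma$ be an $n$-dimensional oriented manifold and let $\phi_t:\Sigma\to\mathbb{S}^{n+1}_{p,1}$, $t\in(-t_0,t_0)$ with $t_0>0$, be a smooth one-parameter deformation of an immersion $\phi:=\phi_{t=0}$ of $\Sigma$ in the real space form $\mathbb{S}^{n+1}_{p,1}$. Then the corresponding Gauss maps $\Phi_t$ form a Hamiltonian variation with respect to the symplectic manifold $(L^{\pm}(\mathbb{S}^{n+1}_{p,1}),\Omega)$.
   Context: Space form: let $n\ge 1$ and $0\le p\le n+2$. $\mathbb{R}^{n+2}$ carries $\langle\cdot,\cdot\rangle_p=-\sum_{i=1}^p dx_i^2+\sum_{i=p+1}^{n+2}dx_i^2$, and $\mathbb{S}^{n+1}_{p,1}=\{x\in\mathbb{R}^{n+2}:\langle x,x\rangle_p=1\}$ with the induced metric (signature $(p,n+1-p)$, constant sectional curvature $1$). Space of oriented geodesics: $L^{\pm}(\mathbb{S}^{n+1}_{p,1})=\{x\wedge y\in\Lambda^2(\mathbb{R}^{n+2}) : x\in\mathbb{S}^{n+1}_{p,1},\ y\in T_x\mathbb{S}^{n+1}_{p,1},\ \langle y,y\rangle_p=\epsilon\}$, with $\epsilon=1$ for $L^+$ and $\epsilon=-1$ for $L^-$; this is the set of spacelike (resp. timelike) oriented geodesics of $\mathbb{S}^{n+1}_{p,1}$. The metric $G$ is the one induced on $L^{\pm}(\mathbb{S}^{n+1}_{p,1})$ by $\langle\langle x_1\wedge y_1,x_2\wedge y_2\rangle\rangle=\langle x_1,x_2\rangle_p\langle y_1,y_2\rangle_p-\langle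 x_1,y_2\rangle_p\langle x_2,y_1\rangle_p$ on $\Lambda^2(\mathbb{R}^{n+2})$. Tangent vectors at $x\wedge y$ (with $\langle x,x\rangle_p=1$, $\langle y,y\rangle_p=\epsilon$, $\langle x,y\rangle_p=0$) have the form $x\wedge X+y\wedge Y$ with $X,Y\in\mathbb{R}^{n+2}$ orthogonal to the plane spanned by $x,y$. The complex ($\epsilon=1$) or paracomplex ($\epsilon=-1$) structure is $\mathbb{J}(x\wedge X+y\wedge Y)=(Jx)\wedge X+(Jy)\wedge Y=y\wedge X-\epsilon\,x\wedge Y$, where $Jx=y$, $Jy=-\epsilon x$. The symplectic form is $\Omega(\cdot,\cdot)=\epsilon G(\mathbb{J}\cdot,\cdot)$, and $(G,\mathbb{J},\Omega)$ is a Kähler ($\epsilon=1$) or para-Kähler ($\epsilon=-1$) structure. Gauss map: for an immersion $\phi:\Sigma^n\to\mathbb{S}^{n+1}_{p,1}$ with unit normal vector field $N$, $\langle N,N\rangle_p=\epsilon$, the Gauss map (normal congruence) is $\Phi=\phi\wedge N:\Sigma\to L^{\pm}(\mathbb{S}^{n+1}_{p,1})$, with values in $L^+$ if $\epsilon=1$ and in $L^-$ if $\epsilon=-1$; it is Lagrangian whenever it is an immersion. $\Phi_t$ denotes the Gauss map of $\phi_t$. Hypersurfaces of $\mathbb{S}^{n+1}_{p,1}$ and Lagrangian submanifolds of $L^{\pm}(\mathbb{S}^{n+1}_{p,1})$ are assumed throughout to have non-degenerate induced metric. Hamiltonian variation: let $(M,J,g,\omega)$ be a (para-)Kähler manifold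 and $\phi:\Sigma\to M$ a Lagrangian immersion. A normal vector field $X$ along $\phi$ is Hamiltonian if $X=J\nabla u$, where $u\in C^\infty(\Sigma)$ and $\nabla u$ is its gradient with respect to the non-degenerate induced metric $\phi^*g$. A variation $(\phi_t)$ of $\phi$ is a Hamiltonian variation if its velocity $X=\partial_t|_{t=0}\phi_t$ is a Hamiltonian vector field, with the additional condition that the function $u$ is compactly supported.
   Formalization: The equation X = J∇u is claimed for the component of the velocity of Φ_t normal to Φ (tangential parts can occur); u is compactly supported when the velocity of φ_t at t=0 is (automatic for compact Σ), and otherwise only smooth. *)

theory Defs
  imports "HOL-Analysis.Analysis"
begin

section \<open>Smooth maps on open subsets of normed spaces\<close>

primrec Ck_on :: "nat \<Rightarrow> ('e::real_normed_vector \<Rightarrow> 'f::real_normed_vector) \<Rightarrow> 'e set \<Rightarrow> bool" where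
  "Ck_on 0 f S \<longleftrightarrow> continuous_on S f"
| "Ck_on (Suc k) f S \<longleftrightarrow>
     (\<forall>x\<in>S. f differentiable (at x)) \<and> (\<forall>v. Ck_on k (\<lambda>x. frechet_derivative f (at x) v) S)"

definition smooth_on :: "('e::real_normed_vector \<Rightarrow> 'f::real_normed_vector) \<Rightarrow> 'e set \<Rightarrow> bool" where
  "smooth_on f S \<longleftrightarrow> (\<forall>k. Ck_on k f S)"


section \<open>Oriented smooth manifolds\<close>

text \<open>An atlas is a set of local parametrizations \<open>(D, q)\<close>: \<open>q\<close> is a homeomorphism from an open
  \<open>D \<subseteq> \<real>\<^sup>n\<close> onto an open subset of the underlying space, i.e. the inverse of a chart.
  The manifold itself is the union of the coordinate neighbourhoods.\<close>

type_synonym ('a, 'n) atlas = "((real^'n) set \<times> (real^'n \<Rightarrow> 'a)) set"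

definition carrier_of :: "('a, 'n) atlas \<Rightarrow> 'a set" where
  "carrier_of A = (\<Union>(D, q)\<in>A. q ` D)"

definition overlap :: "(real^'n) set \<Rightarrow> (real^'n \<Rightarrow> 'a) \<Rightarrow> (real^'n) set \<Rightarrow> (real^'n \<Rightarrow> 'a) \<Rightarrow> (real^'n) set" where
  "overlap D q D' q' = {z \<in> D. q z \<in> q' ` D'}"

definition transition :: "(real^'n \<Rightarrow> 'a) \<Rightarrow> (real^'n) set \<Rightarrow> (real^'n \<Rightarrow> 'a) \<Rightarrow> real^'n \<Rightarrow> real^'n" where
  "transition q D' q' = inv_into D' q' \<circ> q"

definition oriented_manifold ::
    "('a::{t2_space, second_countable_topology}, 'n::finite) atlas \<Rightarrow> bool" where
  "oriented_manifold A \<longleftrightarrow>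
     (\<forall>(D, q)\<in>A. open D \<and> open (q ` D) \<and> (\<exists>r. homeomorphism D (q ` D) q r)) \<and>
     (\<forall>(D, q)\<in>A. \<forall>(D', q')\<in>A.
        smooth_on (transition q D' q') (overlap D q D' q') \<and>
        (\<forall>z\<in>overlap D q D' q'.
           det (matrix (frechet_derivative (transition q D' q') (at z))) > 0))"

definition smooth_map :: "('a, 'n::finite) atlas \<Rightarrow> ('a \<Rightarrow> 'v::real_normed_vector) \<Rightarrow> bool" where
  "smooth_map A F \<longleftrightarrow> (\<forall>(D, q)\<in>A. smooth_on (F \<circ> q) D)"

definition smooth_family ::
    "('a, 'n::finite) atlas \<Rightarrow> real \<Rightarrow> (real \<Rightarrow> 'a \<Rightarrow> 'v::real_normed_vector) \<Rightarrow> bool" where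
  "smooth_family A t0 F \<longleftrightarrow>
     (\<forall>(D, q)\<in>A. smooth_on (\<lambda>(t, z). F t (q z)) ({-t0<..<t0} \<times> D))"

text \<open>Tangent vectors of the manifold at \<open>q z\<close> are represented by their coordinate vectors
  \<open>v \<in> \<real>\<^sup>n\<close> with respect to \<open>q\<close>; \<open>dmap F q z v\<close> is the image of such a vector under \<open>dF\<close>.\<close>

definition dmap ::
    "('a \<Rightarrow> 'v::real_normed_vector) \<Rightarrow> (real^'n::finite \<Rightarrow> 'a) \<Rightarrow> real^'n \<Rightarrow> real^'n \<Rightarrow> 'v" where
  "dmap F q z v = frechet_derivative (F \<circ> q) (at z) v"

definition immersion :: "('a, 'n::finite) atlas \<Rightarrow> ('a \<Rightarrow> 'v::real_normed_vector) \<Rightarrow> bool" where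
  "immersion A F \<longleftrightarrow> smooth_map A F \<and> (\<forall>(D, q)\<in>A. \<forall>z\<in>D. inj (dmap F q z))"

definition compactly_supported :: "'a::topological_space set \<Rightarrow> ('a \<Rightarrow> 'v::zero) \<Rightarrow> bool" where
  "compactly_supported M f \<longleftrightarrow> (\<exists>K. compact K \<and> K \<subseteq> M \<and> (\<forall>x\<in>M - K. f x = 0))"


section \<open>Hamiltonian variations\<close>

text \<open>The ambient (para-)Kaehler manifold is a subset \<open>M\<close> of a vector space. Its metric is the
  restriction of a symmetric bilinear form \<open>g\<close> of that vector space, and \<open>J l\<close> and \<open>om l\<close>
  are the (para)complex structure and the symplectic form on the tangent space at \<open>l \<in> M\<close>.\<close>

definition nondegenerate_metric ::
    "('a, 'n::finite) atlas \<Rightarrow> ('v \<Rightarrow> 'v \<Rightarrow> real) \<Rightarrow> ('a \<Rightarrow> 'v::real_normed_vector) \<Rightarrow> bool" where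
  "nondegenerate_metric A g F \<longleftrightarrow>
     (\<forall>(D, q)\<in>A. \<forall>z\<in>D. \<forall>v. (\<forall>w. g (dmap F q z v) (dmap F q z w) = 0) \<longrightarrow> v = 0)"

definition gradient ::
    "('v \<Rightarrow> 'v \<Rightarrow> real) \<Rightarrow> ('a \<Rightarrow> 'v::real_normed_vector) \<Rightarrow> (real^'n::finite \<Rightarrow> 'a) \<Rightarrow> ('a \<Rightarrow> real)
      \<Rightarrow> real^'n \<Rightarrow> real^'n" where
  "gradient g F q u z = (THE v. \<forall>w. g (dmap F q z v) (dmap F q z w) = dmap u q z w)"

definition normal_component ::
    "('v \<Rightarrow> 'v \<Rightarrow> real) \<Rightarrow> 'v set \<Rightarrow> 'v::real_normed_vector \<Rightarrow> 'v" where
  "normal_component g T X = (THE W. X - W \<in> T \<and> (\<forall>V\<in>T. g W V = 0))"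

definition velocity :: "(real \<Rightarrow> 'a \<Rightarrow> 'v::real_normed_vector) \<Rightarrow> 'a \<Rightarrow> 'v" where
  "velocity F x = vector_derivative (\<lambda>t. F t x) (at 0)"

definition lagrangian_immersion ::
    "('a, 'n::finite) atlas \<Rightarrow> 'v set \<Rightarrow> ('v \<Rightarrow> 'v \<Rightarrow> real) \<Rightarrow> ('v \<Rightarrow> 'v \<Rightarrow> 'v \<Rightarrow> real)
      \<Rightarrow> ('a \<Rightarrow> 'v::real_normed_vector) \<Rightarrow> bool" where
  "lagrangian_immersion A M g om F \<longleftrightarrow>
     immersion A F \<and> F ` carrier_of A \<subseteq> M \<and> nondegenerate_metric A g F \<and>
     (\<forall>(D, q)\<in>A. \<forall>z\<in>D. \<forall>v w. om (F (q z)) (dmap F q z v) (dmap F q z w) = 0)"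

text \<open>The last clause says \<open>X = J \<nabla>u\<close>, where \<open>X\<close> is the component of the velocity normal to the
  immersion \<open>F 0\<close>. The tangential component of the velocity, which only amounts to an
  infinitesimal reparametrization, is unrestricted: it does not vanish for Gauss maps in general,
  not even when the underlying hypersurface is deformed in the normal direction.\<close>

definition hamiltonian_variation_by ::
    "('a, 'n::finite) atlas \<Rightarrow> 'v set \<Rightarrow> ('v \<Rightarrow> 'v \<Rightarrow> real) \<Rightarrow> ('v \<Rightarrow> 'v \<Rightarrow> 'v)
      \<Rightarrow> ('v \<Rightarrow> 'v \<Rightarrow> 'v \<Rightarrow> real) \<Rightarrow> real \<Rightarrow> (real \<Rightarrow> 'a \<Rightarrow> 'v::real_normed_vector)
      \<Rightarrow> ('a \<Rightarrow> real) \<Rightarrow> bool" where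
  "hamiltonian_variation_by A M g J om t0 F u \<longleftrightarrow>
     lagrangian_immersion A M g om (F 0) \<and>
     smooth_family A t0 F \<and>
     (\<forall>t\<in>{-t0<..<t0}. F t ` carrier_of A \<subseteq> M) \<and>
     smooth_map A u \<and>
     (\<forall>(D, q)\<in>A. \<forall>z\<in>D.
        normal_component g (range (dmap (F 0) q z)) (velocity F (q z)) =
        J (F 0 (q z)) (dmap (F 0) q z (gradient g (F 0) q u z)))"

definition hamiltonian_variation ::
    "('a::topological_space, 'n::finite) atlas \<Rightarrow> 'v set \<Rightarrow> ('v \<Rightarrow> 'v \<Rightarrow> real) \<Rightarrow> ('v \<Rightarrow> 'v \<Rightarrow> 'v)
      \<Rightarrow> ('v \<Rightarrow> 'v \<Rightarrow> 'v \<Rightarrow> real) \<Rightarrow> real \<Rightarrow> (real \<Rightarrow> 'a \<Rightarrow> 'v::real_normed_vector) \<Rightarrow> bool" where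
  "hamiltonian_variation A M g J om t0 F \<longleftrightarrow>
     (\<exists>u. hamiltonian_variation_by A M g J om t0 F u \<and> compactly_supported (carrier_of A) u)"


section \<open>The pseudo-Riemannian space form\<close>

text \<open>The form of signature \<open>(p, m - p)\<close> on \<open>\<real>\<^sup>m\<close>. The coordinates are indexed by a finite
  type, which carries no order, so the \<open>p\<close> negative coordinates are given as a set \<open>P\<close> of
  indices with \<open>p = card P\<close>.\<close>

definition psign :: "'m set \<Rightarrow> 'm \<Rightarrow> real" where
  "psign P i = (if i \<in> P then -1 else 1)"

definition pinner :: "'m::finite set \<Rightarrow> real^'m \<Rightarrow> real^'m \<Rightarrow> real" where
  "pinner P x y = (\<Sum>i\<in>UNIV. psign P i * (x $ i) * (y $ i))"

definition pseudosphere :: "'m::finite set \<Rightarrow> (real^'m) set" where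
  "pseudosphere P = {x. pinner P x x = 1}"

definition tangent_sphere :: "'m::finite set \<Rightarrow> real^'m \<Rightarrow> (real^'m) set" where
  "tangent_sphere P x = {y. pinner P x y = 0}"


section \<open>The space of oriented geodesics\<close>

text \<open>\<open>\<Lambda>\<^sup>2(\<real>\<^sup>m)\<close> is realised as the space of skew-symmetric matrices.\<close>

definition wedge :: "real^'m \<Rightarrow> real^'m \<Rightarrow> real^'m^'m" where
  "wedge x y = (\<chi> i j. x $ i * y $ j - x $ j * y $ i)"

definition bivector_inner :: "'m::finite set \<Rightarrow> real^'m^'m \<Rightarrow> real^'m^'m \<Rightarrow> real" where
  "bivector_inner P A B =
     (\<Sum>i\<in>UNIV. \<Sum>j\<in>UNIV. psign P i * psign P j * (A $ i $ j) * (B $ i $ j)) / 2"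

definition oriented_geodesics :: "'m::finite set \<Rightarrow> real \<Rightarrow> (real^'m^'m) set" where
  "oriented_geodesics P eps =
     {wedge x y | x y. x \<in> pseudosphere P \<and> y \<in> tangent_sphere P x \<and> pinner P y y = eps}"

definition plane_orthogonal :: "'m::finite set \<Rightarrow> real^'m \<Rightarrow> real^'m \<Rightarrow> (real^'m) set" where
  "plane_orthogonal P x y = {X. pinner P X x = 0 \<and> pinner P X y = 0}"

text \<open>The structure at \<open>l = x \<and> y\<close>; independence of the choices is \<open>JJ_wedge\<close> below.\<close>

definition JJ :: "'m::finite set \<Rightarrow> real \<Rightarrow> real^'m^'m \<Rightarrow> real^'m^'m \<Rightarrow> real^'m^'m" where
  "JJ P eps l A = (THE B. \<exists>x y X Y.
     x \<in> pseudosphere P \<and> y \<in> tangent_sphere P x \<and> pinner P y y = eps \<and> l = wedge x y \<and>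
     X \<in> plane_orthogonal P x y \<and> Y \<in> plane_orthogonal P x y \<and>
     A = wedge x X + wedge y Y \<and> B = wedge y X - eps *\<^sub>R wedge x Y)"

definition Omega :: "'m::finite set \<Rightarrow> real \<Rightarrow> real^'m^'m \<Rightarrow> real^'m^'m \<Rightarrow> real^'m^'m \<Rightarrow> real" where
  "Omega P eps l A B = eps * bivector_inner P (JJ P eps l A) B"


section \<open>Gauss maps\<close>

text \<open>For an \<open>n\<close>-dimensional manifold the coordinates of \<open>\<real>\<^sup>n\<^sup>+\<^sup>2\<close> are indexed by
  \<open>'n option option\<close>, a type with \<open>n + 2\<close> elements. The orientation of the manifold selects the
  sign of the unit normal: for a positively oriented frame \<open>e\<^sub>1, ..., e\<^sub>n\<close> the basis formed by
  \<open>\<phi>, N, d\<phi>(e\<^sub>1), ..., d\<phi>(e\<^sub>n)\<close>, in the fixed order given by the index type, is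
  positive. Reversing the orientation of the manifold gives the opposite normal.\<close>

definition frame_matrix ::
    "real^('n::finite option option) \<Rightarrow> real^('n option option) \<Rightarrow> ('n \<Rightarrow> real^('n option option))
      \<Rightarrow> real^('n option option)^('n option option)" where
  "frame_matrix x y e = (\<chi> k. case k of None \<Rightarrow> x | Some None \<Rightarrow> y | Some (Some i) \<Rightarrow> e i)"

definition unit_normal ::
    "('a, 'n::finite) atlas \<Rightarrow> 'n option option set \<Rightarrow> real \<Rightarrow> ('a \<Rightarrow> real^('n option option))
      \<Rightarrow> ('a \<Rightarrow> real^('n option option)) \<Rightarrow> bool" where
  "unit_normal A P eps f N \<longleftrightarrow>
     (\<forall>(D, q)\<in>A. \<forall>z\<in>D.
        N (q z) \<in> tangent_sphere P (f (q z)) \<and>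
        pinner P (N (q z)) (N (q z)) = eps \<and>
        (\<forall>v. pinner P (N (q z)) (dmap f q z v) = 0) \<and>
        det (frame_matrix (f (q z)) (N (q z)) (\<lambda>i. dmap f q z (axis i 1))) > 0)"

definition gauss_map ::
    "('a \<Rightarrow> real^'m) \<Rightarrow> ('a \<Rightarrow> real^'m) \<Rightarrow> 'a \<Rightarrow> real^'m^'m" where
  "gauss_map f N x = wedge (f x) (N x)"


section \<open>Consistency of the definitions\<close>

lemma bivector_inner_wedge:
  "bivector_inner P (wedge x1 y1) (wedge x2 y2) =
     pinner P x1 x2 * pinner P y1 y2 - pinner P x1 y2 * pinner P x2 y1"
proof -
  define S where "S a b c d = (\<Sum>i\<in>UNIV. \<Sum>j\<in>UNIV.
      (psign P i * (a $ i) * (b $ i)) * (psign P j * (c $ j) * (d $ j)))" for a b c d :: "real^'a"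
  have S: "S a b c d = pinner P a b * pinner P c d" for a b c d
    by (simp add: S_def pinner_def sum_product)
  have "(\<Sum>i\<in>UNIV. \<Sum>j\<in>UNIV.
          psign P i * psign P j * (wedge x1 y1 $ i $ j) * (wedge x2 y2 $ i $ j)) =
        S x1 x2 y1 y2 - S x1 y2 y1 x2 - S y1 x2 x1 y2 + S y1 y2 x1 x2"
    by (simp add: S_def wedge_def sum.distrib[symmetric] sum_subtractf[symmetric] algebra_simps)
  then show ?thesis
    by (simp add: bivector_inner_def S pinner_def mult.commute mult.left_commute)
qed

lemma JJ_wedge:
  fixes x y :: "real^'m::finite"
  assumes eps: "eps = 1 \<or> eps = -1"
    and x: "x \<in> pseudosphere P" and y: "y \<in> tangent_sphere P x" "pinner P y y = eps"
    and X: "X \<in> plane_orthogonal P x y" and Y: "Y \<in> plane_orthogonal P x y"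
  shows "JJ P eps (wedge x y) (wedge x X + wedge y Y) = wedge y X - eps *\<^sub>R wedge x Y"
proof -
  have comm: "pinner P a b = pinner P b a" for a b :: "real^'m"
    by (simp add: pinner_def mult.commute mult.left_commute)
  have add: "pinner P a (b + c) = pinner P a b + pinner P a c"
    and scale: "pinner P a (r *\<^sub>R b) = r * pinner P a b"
    and diff: "pinner P a (b - c) = pinner P a b - pinner P a c" for a b c :: "real^'m" and r
    by (simp_all add: pinner_def algebra_simps sum.distrib sum_subtractf sum_distrib_left)
  define con :: "real^'m^'m \<Rightarrow> real^'m \<Rightarrow> real^'m"
    where "con A v = (\<chi> i. pinner P (A $ i) v)" for A v
  have con_wedge: "con (wedge a b) v = pinner P b v *\<^sub>R a - pinner P a v *\<^sub>R b" for a b v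
    by (simp add: con_def vec_eq_iff wedge_def pinner_def sum_distrib_left
        sum_subtractf algebra_simps)
  have con_add1: "con (A + B) v = con A v + con B v" for A B v
    by (simp add: con_def vec_eq_iff pinner_def algebra_simps sum.distrib)
  have con_add: "con A (v + w) = con A v + con A w"
    and con_diff: "con A (v - w) = con A v - con A w"
    and con_scale: "con A (r *\<^sub>R v) = r *\<^sub>R con A v" for A v w r
    by (simp_all add: con_def vec_eq_iff add diff scale)
  have ee: "eps * eps = 1" using eps by auto
  have x1: "pinner P x x = 1" "pinner P x y = 0" "pinner P y x = 0"
    using x y by (auto simp: pseudosphere_def tangent_sphere_def comm)
  have XY: "pinner P X x = 0" "pinner P X y = 0" "pinner P Y x = 0" "pinner P Y y = 0"
    using X Y by (auto simp: plane_orthogonal_def)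
  define A where "A = wedge x X + wedge y Y"
  have Ax: "con A x = - X" and Ay: "con A y = - (eps *\<^sub>R Y)"
    by (simp_all add: A_def con_add1 con_wedge x1 XY y)
  have uniq: "wedge y' X' - eps *\<^sub>R wedge x' Y' = wedge y X - eps *\<^sub>R wedge x Y"
    if h: "x' \<in> pseudosphere P" "y' \<in> tangent_sphere P x'" "pinner P y' y' = eps"
      "wedge x y = wedge x' y'" "X' \<in> plane_orthogonal P x' y'" "Y' \<in> plane_orthogonal P x' y'"
      "A = wedge x' X' + wedge y' Y'" for x' y' X' Y'
  proof -
    have h1: "pinner P x' x' = 1" "pinner P x' y' = 0" "pinner P y' x' = 0"
      using h by (auto simp: pseudosphere_def tangent_sphere_def comm)
    have h2: "pinner P X' x' = 0" "pinner P X' y' = 0" "pinner P Y' x' = 0" "pinner P Y' y' = 0"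
      using h by (auto simp: plane_orthogonal_def)
    define a where "a = pinner P x x'"
    define b where "b = pinner P y x'"
    have y': "y' = a *\<^sub>R y - b *\<^sub>R x"
    proof -
      have "- y' = b *\<^sub>R x - a *\<^sub>R y"
        using con_wedge[of x' y' x'] con_wedge[of x y x'] h(4) h1 by (simp add: a_def b_def)
      then show ?thesis by (metis minus_diff_eq minus_equation_iff)
    qed
    have "pinner P y y' = a * eps" "pinner P x y' = - b"
      by (simp_all add: y' diff scale x1 y)
    then have "eps *\<^sub>R x' = (a * eps) *\<^sub>R x + b *\<^sub>R y"
      using con_wedge[of x' y' y'] con_wedge[of x y y'] h(4) h1 h(3) by simp
    then have x': "x' = a *\<^sub>R x + (eps * b) *\<^sub>R y"
      using eps by (auto simp: vec_eq_iff algebra_simps)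
    have "pinner P x' x' = a * a + eps * (b * b)"
    proof -
      have "pinner P x' x' = a * pinner P x' x + eps * b * pinner P x' y"
        by (subst (2) x') (simp add: add scale)
      then show ?thesis by (simp only: a_def b_def comm[of x' x] comm[of x' y] mult.assoc)
    qed
    then have ab: "a * a + eps * (b * b) = 1" using h1 by simp
    have "con A x' = - X'" and "con A y' = - (eps *\<^sub>R Y')"
      by (simp_all add: h(7) con_add1 con_wedge h1 h2 h(3))
    moreover have "con A x' = - (a *\<^sub>R X) - (eps * b * eps) *\<^sub>R Y"
      by (simp add: x' con_add con_scale Ax Ay)
    moreover have "con A y' = - ((a * eps) *\<^sub>R Y) + b *\<^sub>R X"
      by (simp add: y' con_diff con_scale Ax Ay)
    ultimately have "- X' = - (a *\<^sub>R X) - (eps * b * eps) *\<^sub>R Y"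
      "- (eps *\<^sub>R Y') = - ((a * eps) *\<^sub>R Y) + b *\<^sub>R X" by simp_all
    then have X': "X' = a *\<^sub>R X + b *\<^sub>R Y" and eY': "eps *\<^sub>R Y' = (a * eps) *\<^sub>R Y - b *\<^sub>R X"
      using eps by (auto simp: vec_eq_iff algebra_simps)
    have Y': "Y' = a *\<^sub>R Y - (eps * b) *\<^sub>R X"
      using eY' eps by (auto simp: vec_eq_iff algebra_simps)
    have "wedge y' X' - eps *\<^sub>R wedge x' Y' =
        (a * a + eps * eps * eps * (b * b)) *\<^sub>R wedge y X
        - (eps * (a * a) + b * b) *\<^sub>R wedge x Y
        + (a * b - eps * eps * (a * b)) *\<^sub>R wedge y Y
        + (eps * eps * (a * b) - a * b) *\<^sub>R wedge x X"
      by (simp add: vec_eq_iff wedge_def x' y' X' Y' algebra_simps)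
    moreover have "eps * (a * a) + b * b = eps" using ab eps by auto
    ultimately show ?thesis using ab ee by (simp add: mult.assoc)
  qed
  show ?thesis
    unfolding JJ_def
  proof (rule the_equality, goal_cases)
    case 1
    then show ?case using assms by blast
  next
    case (2 B)
    then show ?case using uniq unfolding A_def by blast
  qed
qed

end

theory Submission
  imports Defs
begin

text \<open>Write \<open>x = \<phi>\<close>, \<open>y = N\<close> at time \<open>0\<close> and \<open>x', y'\<close> for their time derivatives. Then
  \<open>d\<Phi>(v) = x \<and> dN(v) - y \<and> d\<phi>(v)\<close> and the velocity is \<open>V = x' \<and> y + x \<and> y'\<close>. Symmetry of the
  second fundamental form gives \<open>G(J d\<Phi>(v), d\<Phi>(w)) = 0\<close>; nondegeneracy of \<open>\<Phi>\<^sup>*G\<close> and a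
  dimension count then split the tangent space into \<open>d\<Phi>(T)\<close> and \<open>J d\<Phi>(T)\<close>. Differentiating
  \<open>\<langle>N, d\<phi>(w)\<rangle> = 0\<close> in time shows that \<open>u = - \<langle>\<phi>', N\<rangle>\<close> satisfies
  \<open>du(w) = \<langle>y', d\<phi>(w)\<rangle> - \<langle>x', dN(w)\<rangle> = \<epsilon> G(J d\<Phi>(w), V)\<close>, which is also
  \<open>\<epsilon> G(J d\<Phi>(w), J d\<Phi>(\<nabla>u))\<close>. Hence \<open>J d\<Phi>(\<nabla>u)\<close> is the normal part of \<open>V\<close>.

  The normal fields \<open>N t\<close> are not assumed to be smooth. They are, because the orientation
  determines \<open>N t\<close> as the normalised cross product of \<open>\<phi> t\<close> and its partial derivatives.\<close>

section \<open>Calculus of smooth maps\<close>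

lemma Ck_on_Suc_imp: "Ck_on (Suc k) f S \<Longrightarrow> Ck_on k f S"
proof (induction k arbitrary: f)
  case 0
  then show ?case
    by (auto intro!: continuous_at_imp_continuous_on differentiable_imp_continuous_within)
next
  case (Suc k)
  from Suc.prems have "Ck_on (Suc k) (\<lambda>x. frechet_derivative f (at x) v) S" for v by simp
  from Suc.IH[OF this] Suc.prems show ?case by simp
qed

text \<open>No differentiability is assumed: \<open>f\<close> and \<open>g\<close> have the same
  candidates for a derivative at \<open>x\<close>, so the choice in
  \<open>frechet_derivative\<close> agrees even if there is none.\<close>

lemma frechet_derivative_cong_open:
  assumes "open S" "x \<in> S" "\<And>y. y \<in> S \<Longrightarrow> f y = g y"
  shows "frechet_derivative f (at x) = frechet_derivative g (at x)"
proof -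
  have "(f has_derivative D) (at x) \<longleftrightarrow> (g has_derivative D) (at x)" for D
    using has_derivative_transform_within_open[of f D x UNIV S g]
      has_derivative_transform_within_open[of g D x UNIV S f] assms by auto
  then show ?thesis by (simp add: frechet_derivative_def)
qed

lemma Ck_on_cong:
  assumes "open S" "\<And>x. x \<in> S \<Longrightarrow> f x = g x"
  shows "Ck_on k f S \<longleftrightarrow> Ck_on k g S"
  using assms(2)
proof (induction k arbitrary: f g)
  case 0
  then show ?case by (simp cong: continuous_on_cong)
next
  case (Suc k)
  have "f differentiable at x \<longleftrightarrow> g differentiable at x" if "x \<in> S" for x
    unfolding differentiable_def
    using has_derivative_transform_within_open[of f _ x UNIV S g]
      has_derivative_transform_within_open[of g _ x UNIV S f] assms(1) Suc.prems that by auto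
  moreover have "Ck_on k (\<lambda>x. frechet_derivative f (at x) v) S \<longleftrightarrow>
      Ck_on k (\<lambda>x. frechet_derivative g (at x) v) S" for v
    using frechet_derivative_cong_open[OF assms(1) _ Suc.prems] by (intro Suc.IH) simp
  ultimately show ?case by auto
qed

text \<open>Replaces the chosen \<open>frechet_derivative\<close> by an explicit formula
  \<open>f'\<close>; the closure lemmas below then reduce to a derivative rule and the induction
  hypothesis.\<close>

lemma Ck_on_SucI:
  assumes "open S" "\<And>x. x \<in> S \<Longrightarrow> (f has_derivative f' x) (at x)"
    and "\<And>v. Ck_on k (\<lambda>x. f' x v) S"
  shows "Ck_on (Suc k) f S"
proof -
  have "Ck_on k (\<lambda>x. frechet_derivative f (at x) v) S" for v
    using assms(3)[of v] frechet_derivative_at[OF assms(2)]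
    by (subst Ck_on_cong[OF assms(1), where g = "\<lambda>x. f' x v"]) simp_all
  with assms(2) show ?thesis by (auto simp: differentiable_def)
qed

lemma Ck_on_SucD:
  assumes "Ck_on (Suc k) f S"
  shows "x \<in> S \<Longrightarrow> (f has_derivative frechet_derivative f (at x)) (at x)"
    and "Ck_on k (\<lambda>x. frechet_derivative f (at x) v) S"
  using assms by (auto simp: frechet_derivative_works)

section \<open>Closure of C^k maps under algebraic operations\<close>

lemma Ck_on_const: "Ck_on k (\<lambda>x. c) S"
  by (induction k arbitrary: c) auto

lemma Ck_on_add:
  assumes "open S" "Ck_on k f S" "Ck_on k g S"
  shows "Ck_on k (\<lambda>x. f x + g x) S"
  using assms(2,3)
proof (induction k arbitrary: f g)
  case 0
  then show ?case by (simp add: continuous_on_add)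
next
  case (Suc k)
  show ?case
    by (rule Ck_on_SucI[OF assms(1) has_derivative_add[OF
          Ck_on_SucD(1)[OF Suc.prems(1)] Ck_on_SucD(1)[OF Suc.prems(2)]]
          Suc.IH[OF Ck_on_SucD(2)[OF Suc.prems(1)] Ck_on_SucD(2)[OF Suc.prems(2)]]])
qed

lemma Ck_on_sum:
  assumes "open S" "\<And>i. i \<in> I \<Longrightarrow> Ck_on k (f i) S"
  shows "Ck_on k (\<lambda>x. \<Sum>i\<in>I. f i x) S"
  using assms(2)
proof (induction I rule: infinite_finite_induct)
  case (insert i I)
  then show ?case by (simp add: Ck_on_add[OF assms(1)])
qed (simp_all add: Ck_on_const)

text \<open>Each summand of the product rule keeps one factor undifferentiated. That factor is
  lowered from order \<open>Suc k\<close> to \<open>k\<close>, so that the induction hypothesis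
  applies to both factors.\<close>

lemma (in bounded_bilinear) Ck_on:
  assumes "open S" "Ck_on k f S" "Ck_on k g S"
  shows "Ck_on k (\<lambda>x. prod (f x) (g x)) S"
  using assms(2,3)
proof (induction k arbitrary: f g)
  case 0
  then show ?case by (simp add: continuous_on)
next
  case (Suc k)
  show ?case
    by (rule Ck_on_SucI[OF assms(1) FDERIV[OF
          Ck_on_SucD(1)[OF Suc.prems(1)] Ck_on_SucD(1)[OF Suc.prems(2)]]
          Ck_on_add[OF assms(1)
            Suc.IH[OF Ck_on_Suc_imp[OF Suc.prems(1)] Ck_on_SucD(2)[OF Suc.prems(2)]]
            Suc.IH[OF Ck_on_SucD(2)[OF Suc.prems(1)] Ck_on_Suc_imp[OF Suc.prems(2)]]]])
qed

lemmas Ck_on_mult = bounded_bilinear.Ck_on[OF bounded_bilinear_mult]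
  and Ck_on_scaleR = bounded_bilinear.Ck_on[OF bounded_bilinear_scaleR]

lemma (in bounded_linear) Ck_on:
  assumes "open S" "Ck_on k g S"
  shows "Ck_on k (\<lambda>x. f (g x)) S"
  using assms(2)
proof (induction k arbitrary: g)
  case 0
  then show ?case by (simp add: continuous_on)
next
  case (Suc k)
  show ?case
    by (rule Ck_on_SucI[OF assms(1) has_derivative[OF Ck_on_SucD(1)[OF Suc.prems]]
          Suc.IH[OF Ck_on_SucD(2)[OF Suc.prems]]])
qed

lemma Ck_on_prod:
  fixes f :: "'i \<Rightarrow> 'a::real_normed_vector \<Rightarrow> real"
  assumes "open S" "\<And>i. i \<in> I \<Longrightarrow> Ck_on k (f i) S"
  shows "Ck_on k (\<lambda>x. \<Prod>i\<in>I. f i x) S"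
  using assms(2)
proof (induction I rule: infinite_finite_induct)
  case (insert i I)
  then show ?case by (simp add: Ck_on_mult[OF assms(1)])
qed (simp_all add: Ck_on_const)

text \<open>The exponent is arbitrary in the induction because differentiation lowers it by one. The
  case \<open>-1/2\<close> normalises the cross product below.\<close>

lemma Ck_on_powr:
  fixes f :: "'a::real_normed_vector \<Rightarrow> real"
  assumes "open S" "Ck_on k f S" "\<And>x. x \<in> S \<Longrightarrow> f x > 0"
  shows "Ck_on k (\<lambda>x. f x powr a) S"
  using assms(2)
proof (induction k arbitrary: a)
  case 0
  have "\<forall>x\<in>S. f x \<noteq> 0" using assms(3) by (metis less_irrefl)
  with 0 show ?case by (simp add: continuous_on_powr)
next
  case (Suc k)
  let ?f' = "\<lambda>x. frechet_derivative f (at x)"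
  show ?case
  proof (rule Ck_on_SucI[OF assms(1), where f' = "\<lambda>x v. f x powr (a - 1) * (a * ?f' x v)"])
    show "((\<lambda>x. f x powr a) has_derivative (\<lambda>v. f x powr (a - 1) * (a * ?f' x v))) (at x)"
      if "x \<in> S" for x
    proof -
      have "((\<lambda>x. f x powr a) has_derivative
          (\<lambda>h. (f x powr a) * (0 * ln (f x) + ?f' x h * a / f x))) (at x)"
        using has_derivative_powr[OF Ck_on_SucD(1)[OF Suc.prems that] has_derivative_const
            assms(3)[OF that]] by simp
      moreover have "f x powr (a - 1) = f x powr a / f x"
        using assms(3)[OF that] by (simp add: powr_diff)
      ultimately show ?thesis by (simp add: mult.commute[of a])
    qed
    fix v
    have "Ck_on k (\<lambda>x. f x powr (a - 1)) S"
      by (rule Suc.IH[OF Ck_on_Suc_imp[OF Suc.prems]])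
    moreover have "Ck_on k (\<lambda>x. a * ?f' x v) S"
      by (rule Ck_on_mult[OF assms(1) Ck_on_const Ck_on_SucD(2)[OF Suc.prems]])
    ultimately show "Ck_on k (\<lambda>x. f x powr (a - 1) * (a * ?f' x v)) S"
      by (rule Ck_on_mult[OF assms(1)])
  qed
qed

text \<open>By the chain rule, a directional derivative of the slice is a slice of the derivative in
  direction \<open>(0, v)\<close>, so the induction closes.\<close>

lemma Ck_on_Pair_slice:
  assumes "open D" "Ck_on k f (I \<times> D)" "t \<in> I"
  shows "Ck_on k (\<lambda>z. f (t, z)) D"
  using assms(2)
proof (induction k arbitrary: f)
  case 0
  have "continuous_on D (Pair t)" by (intro continuous_intros)
  moreover have "Pair t ` D \<subseteq> I \<times> D" using assms(3) by blast
  ultimately show ?case using continuous_on_compose2[of "I \<times> D" f D "Pair t"] 0 by simp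
next
  case (Suc k)
  have "((\<lambda>z. f (t, z)) has_derivative (\<lambda>v. frechet_derivative f (at (t, z)) (0, v))) (at z)"
    if "z \<in> D" for z
  proof -
    have "(t, z) \<in> I \<times> D" using that assms(3) by simp
    moreover have "(Pair t has_derivative Pair 0) (at z)"
      by (intro has_derivative_Pair has_derivative_const has_derivative_ident)
    ultimately show ?thesis
      using has_derivative_compose[of "Pair t" "Pair 0" z UNIV f] Ck_on_SucD(1)[OF Suc.prems]
      by simp
  qed
  then show ?case
    by (rule Ck_on_SucI[OF assms(1) _ Suc.IH[OF Ck_on_SucD(2)[OF Suc.prems]]])
qed

section \<open>Symmetry of second derivatives\<close>

lemma mixed_difference_mean_value:
  fixes f :: "'a::real_normed_vector \<Rightarrow> real"
  assumes "Ck_on 2 f U" "s > 0"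
    and U: "\<And>a b. a \<in> {0..s} \<Longrightarrow> b \<in> {0..s} \<Longrightarrow> p + a *\<^sub>R h + b *\<^sub>R k \<in> U"
  shows "\<exists>a\<in>{0..s}. \<exists>b\<in>{0..s}.
    f (p + s *\<^sub>R h + s *\<^sub>R k) - f (p + s *\<^sub>R h) - f (p + s *\<^sub>R k) + f p =
    s * s * frechet_derivative (\<lambda>x. frechet_derivative f (at x) h) (at (p + a *\<^sub>R h + b *\<^sub>R k)) k"
proof -
  let ?f' = "\<lambda>x. frechet_derivative f (at x)"
  let ?fh = "\<lambda>x. ?f' x h"
  have C: "Ck_on (Suc (Suc 0)) f U" using assms(1) by (simp add: numeral_2_eq_2 del: Ck_on.simps)
  have lin: "linear (?f' x)" if "x \<in> U" for x
    by (rule has_derivative_linear[OF Ck_on_SucD(1)[OF C that]])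
  have lin2: "linear (frechet_derivative ?fh (at x))" if "x \<in> U" for x
    by (rule has_derivative_linear[OF Ck_on_SucD(1)[OF Ck_on_SucD(2)[OF C] that]])
  have 1: "((\<lambda>a. f (p + a *\<^sub>R h + c *\<^sub>R k)) has_real_derivative ?fh (p + a *\<^sub>R h + c *\<^sub>R k)) (at a)"
    if "a \<in> {0..s}" "c \<in> {0..s}" for a c
  proof -
    have "((\<lambda>a. f (p + a *\<^sub>R h + c *\<^sub>R k)) has_derivative
        (\<lambda>t. ?f' (p + a *\<^sub>R h + c *\<^sub>R k) (t *\<^sub>R h))) (at a)"
      by (rule has_derivative_compose[where f = "\<lambda>a. p + a *\<^sub>R h + c *\<^sub>R k",
            OF _ Ck_on_SucD(1)[OF C U[OF that]]])
        (auto intro!: derivative_eq_intros)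
    then show ?thesis
      using lin[OF U[OF that]] by (simp add: has_field_derivative_def linear_cmul mult.commute[of _ "?fh _"])
  qed
  have 2: "((\<lambda>b. ?fh (p + a *\<^sub>R h + b *\<^sub>R k)) has_real_derivative
      frechet_derivative ?fh (at (p + a *\<^sub>R h + b *\<^sub>R k)) k) (at b)"
    if "a \<in> {0..s}" "b \<in> {0..s}" for a b
  proof -
    have "((\<lambda>b. ?fh (p + a *\<^sub>R h + b *\<^sub>R k)) has_derivative
        (\<lambda>t. frechet_derivative ?fh (at (p + a *\<^sub>R h + b *\<^sub>R k)) (t *\<^sub>R k))) (at b)"
      by (rule has_derivative_compose[where f = "\<lambda>b. p + a *\<^sub>R h + b *\<^sub>R k",
            OF _ Ck_on_SucD(1)[OF Ck_on_SucD(2)[OF C] U[OF that]]])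
        (auto intro!: derivative_eq_intros)
    then show ?thesis
      using lin2[OF U[OF that]]
      by (simp add: has_field_derivative_def linear_cmul mult.commute[of _ "frechet_derivative ?fh _ _"])
  qed
  \<comment> \<open>The mean value theorem is applied first to the difference of the slices at
    \<open>s *\<^sub>R k\<close> and \<open>0 *\<^sub>R k\<close>, as a function of the coefficient
    of \<open>h\<close>; then to the derivative in direction \<open>h\<close>, as a function of the
    coefficient of \<open>k\<close>. The zero multiples keep every term in the shape of
    \<open>1\<close> and \<open>2\<close>.\<close>
  have "\<exists>a>0. a < s \<and> (f (p + s *\<^sub>R h + s *\<^sub>R k) - f (p + s *\<^sub>R h + 0 *\<^sub>R k)) -
      (f (p + 0 *\<^sub>R h + s *\<^sub>R k) - f (p + 0 *\<^sub>R h + 0 *\<^sub>R k)) =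
      (s - 0) * (?fh (p + a *\<^sub>R h + s *\<^sub>R k) - ?fh (p + a *\<^sub>R h + 0 *\<^sub>R k))"
    by (rule MVT2[OF assms(2)]) (use assms(2) in \<open>intro DERIV_diff 1; simp\<close>)
  then obtain a where a: "0 < a" "a < s" "f (p + s *\<^sub>R h + s *\<^sub>R k) - f (p + s *\<^sub>R h)
      - f (p + s *\<^sub>R k) + f p = s * (?fh (p + a *\<^sub>R h + s *\<^sub>R k) - ?fh (p + a *\<^sub>R h + 0 *\<^sub>R k))"
    by (auto simp: algebra_simps)
  have "\<exists>b>0. b < s \<and> ?fh (p + a *\<^sub>R h + s *\<^sub>R k) - ?fh (p + a *\<^sub>R h + 0 *\<^sub>R k) =
      (s - 0) * frechet_derivative ?fh (at (p + a *\<^sub>R h + b *\<^sub>R k)) k"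
    by (rule MVT2[OF assms(2)]) (use a in \<open>intro 2; simp\<close>)
  with a show ?thesis by (force simp: mult.assoc)
qed

text \<open>The second difference of \<open>f\<close> over a small parallelogram is symmetric in
  \<open>h\<close> and \<open>k\<close>. Up to the factor \<open>s * s\<close> it equals either
  mixed derivative at some nearby point, and both are continuous at \<open>p\<close>.\<close>

lemma second_derivative_symmetric_real:
  fixes f :: "'a::real_normed_vector \<Rightarrow> real"
  assumes "open U" "Ck_on 2 f U" "p \<in> U"
  shows "frechet_derivative (\<lambda>x. frechet_derivative f (at x) h) (at p) k =
         frechet_derivative (\<lambda>x. frechet_derivative f (at x) k) (at p) h"
proof -
  define H where "H h k x = frechet_derivative (\<lambda>x. frechet_derivative f (at x) h) (at x) k" for h k x
  have "continuous_on U (H h k)" for h k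
    using assms(2) by (simp add: H_def numeral_2_eq_2)
  then have cont: "\<exists>d>0. \<forall>x. dist x p < d \<longrightarrow> dist (H h k x) (H h k p) < e" if "e > 0" for h k e
    using assms that by (simp add: continuous_on_eq_continuous_at continuous_at_eps_delta)
  have "\<bar>H h k p - H k h p\<bar> \<le> e + e" if e: "e > 0" for e
  proof -
    obtain d1 where d1: "d1 > 0" "\<And>x. dist x p < d1 \<Longrightarrow> dist (H h k x) (H h k p) < e"
      using cont[OF e, of h k] by blast
    obtain d2 where d2: "d2 > 0" "\<And>x. dist x p < d2 \<Longrightarrow> dist (H k h x) (H k h p) < e"
      using cont[OF e, of k h] by blast
    obtain d3 where d3: "d3 > 0" "ball p d3 \<subseteq> U"
      using assms openE by blast
    define d where "d = min d1 (min d2 d3)"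
    have d: "d > 0" "d \<le> d1" "d \<le> d2" "d \<le> d3" using d1 d2 d3 by (auto simp: d_def)
    \<comment> \<open>This side length keeps the closed parallelogram within distance
      \<open>d\<close> of \<open>p\<close>; the summand 1 keeps the denominator positive when
      \<open>h\<close> and \<open>k\<close> vanish.\<close>
    define s where "s = d / (2 * (norm h + norm k + 1))"
    have den: "norm h + norm k + 1 > 0" using norm_ge_zero[of h] norm_ge_zero[of k] by linarith
    have s: "s > 0" using d den by (simp add: s_def)
    have near: "norm (a *\<^sub>R h + b *\<^sub>R k) < d" if "a \<in> {0..s}" "b \<in> {0..s}" for a b
    proof -
      have "norm (a *\<^sub>R h + b *\<^sub>R k) \<le> \<bar>a\<bar> * norm h + \<bar>b\<bar> * norm k"
        by (metis norm_triangle_ineq norm_scaleR)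
      also have "\<dots> \<le> s * norm h + s * norm k"
        using that by (intro add_mono mult_right_mono) auto
      also have "\<dots> \<le> s * (norm h + norm k + 1)" using s by (simp add: algebra_simps)
      also have "\<dots> = d / 2"
        unfolding s_def using den by (simp add: divide_simps del: distrib_left_numeral)
      also have "\<dots> < d" using d by simp
      finally show ?thesis .
    qed
    have near': "dist (p + a *\<^sub>R h + b *\<^sub>R k) p < d" if "a \<in> {0..s}" "b \<in> {0..s}" for a b
      using near[OF that] by (simp add: dist_norm add.assoc)
    have near'': "dist (p + a *\<^sub>R k + b *\<^sub>R h) p < d" if "a \<in> {0..s}" "b \<in> {0..s}" for a b
      using near[OF that(2,1)] by (simp add: dist_norm add.assoc add.commute)
    have U: "p + a *\<^sub>R h + b *\<^sub>R k \<in> U" "p + a *\<^sub>R k + b *\<^sub>R h \<in> U"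
      if "a \<in> {0..s}" "b \<in> {0..s}" for a b
      using near'[OF that] near''[OF that] d d3 by (auto simp: dist_commute)
    obtain a b where ab: "a \<in> {0..s}" "b \<in> {0..s}"
      "f (p + s *\<^sub>R h + s *\<^sub>R k) - f (p + s *\<^sub>R h) - f (p + s *\<^sub>R k) + f p =
        s * s * H h k (p + a *\<^sub>R h + b *\<^sub>R k)"
      using mixed_difference_mean_value[OF assms(2) s U(1)] unfolding H_def by blast
    obtain a' b' where ab': "a' \<in> {0..s}" "b' \<in> {0..s}"
      "f (p + s *\<^sub>R k + s *\<^sub>R h) - f (p + s *\<^sub>R k) - f (p + s *\<^sub>R h) + f p =
        s * s * H k h (p + a' *\<^sub>R k + b' *\<^sub>R h)"
      using mixed_difference_mean_value[OF assms(2) s U(2)] unfolding H_def by blast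
    have "s * s * H h k (p + a *\<^sub>R h + b *\<^sub>R k) = s * s * H k h (p + a' *\<^sub>R k + b' *\<^sub>R h)"
      using ab(3) ab'(3) by (simp add: algebra_simps)
    then have eq: "H h k (p + a *\<^sub>R h + b *\<^sub>R k) = H k h (p + a' *\<^sub>R k + b' *\<^sub>R h)"
      using s by simp
    have "dist (H h k (p + a *\<^sub>R h + b *\<^sub>R k)) (H h k p) < e"
      using d1(2) near'[OF ab(1,2)] d by force
    moreover have "dist (H k h (p + a' *\<^sub>R k + b' *\<^sub>R h)) (H k h p) < e"
      using d2(2) near''[OF ab'(1,2)] d by force
    ultimately show ?thesis using eq by (simp add: dist_real_def)
  qed
  \<comment> \<open>A nonzero difference would be bounded by half of its own absolute value.\<close>
  from this[of "\<bar>H h k p - H k h p\<bar> / 4"] have "H h k p = H k h p" by fastforce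
  then show ?thesis by (simp add: H_def)
qed

lemma (in bounded_linear) frechet_derivative:
  assumes "g differentiable at x"
  shows "frechet_derivative (\<lambda>x. f (g x)) (at x) v = f (frechet_derivative g (at x) v)"
  using frechet_derivative_at[OF has_derivative[OF assms[unfolded frechet_derivative_works]]] by metis

text \<open>Reduces to the real case through the components \<open>f x \<bullet> b\<close>, since
  taking an inner product with \<open>b\<close> commutes with differentiation.\<close>

lemma second_derivative_symmetric:
  fixes f :: "'a::real_normed_vector \<Rightarrow> 'b::euclidean_space"
  assumes "open U" "Ck_on 2 f U" "p \<in> U"
  shows "frechet_derivative (\<lambda>x. frechet_derivative f (at x) h) (at p) k =
         frechet_derivative (\<lambda>x. frechet_derivative f (at x) k) (at p) h"
proof (rule euclidean_eqI)
  fix b :: 'b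
  interpret bounded_linear "\<lambda>x. x \<bullet> b" by (rule bounded_linear_inner_left)
  have C: "Ck_on (Suc (Suc 0)) f U" using assms(2) by (simp add: numeral_2_eq_2 del: Ck_on.simps)
  have *: "frechet_derivative (\<lambda>x. frechet_derivative f (at x) h) (at p) k \<bullet> b =
      frechet_derivative (\<lambda>x. frechet_derivative (\<lambda>x. f x \<bullet> b) (at x) h) (at p) k" for h k
  proof -
    have "frechet_derivative (\<lambda>x. f x \<bullet> b) (at x) h = frechet_derivative f (at x) h \<bullet> b"
      if "x \<in> U" for x
      using C that by (intro frechet_derivative) simp
    then have "frechet_derivative (\<lambda>x. frechet_derivative (\<lambda>x. f x \<bullet> b) (at x) h) (at p) =
        frechet_derivative (\<lambda>x. frechet_derivative f (at x) h \<bullet> b) (at p)"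
      using assms by (intro frechet_derivative_cong_open) auto
    moreover have "(\<lambda>x. frechet_derivative f (at x) h) differentiable at p"
      using C assms(3) by simp
    ultimately show ?thesis by (simp add: frechet_derivative)
  qed
  show "frechet_derivative (\<lambda>x. frechet_derivative f (at x) h) (at p) k \<bullet> b =
         frechet_derivative (\<lambda>x. frechet_derivative f (at x) k) (at p) h \<bullet> b"
    unfolding * by (rule second_derivative_symmetric_real[OF assms(1) Ck_on[OF assms(1,2)] assms(3)])
qed

section \<open>Partial derivatives in space and time\<close>

lemma frechet_derivative_slice:
  assumes "f differentiable at (t, z)"
  shows "frechet_derivative (\<lambda>z. f (t, z)) (at z) v = frechet_derivative f (at (t, z)) (0, v)"
proof -
  have "(Pair t has_derivative Pair 0) (at z)"
    by (intro has_derivative_Pair has_derivative_const has_derivative_ident)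
  from has_derivative_compose[OF this assms[unfolded frechet_derivative_works]]
  show ?thesis by (rule frechet_derivative_at[THEN fun_cong, symmetric])
qed

text \<open>Makes velocity a directional derivative of the joint map, so that symmetry of second
  derivatives also exchanges time and space directions.\<close>

lemma vector_derivative_slice:
  fixes f :: "real \<times> 'b::real_normed_vector \<Rightarrow> 'c::real_normed_vector"
  assumes "f differentiable at (t, z)"
  shows "vector_derivative (\<lambda>t. f (t, z)) (at t) = frechet_derivative f (at (t, z)) (1, 0)"
proof -
  have "((\<lambda>t. (t, z)) has_derivative (\<lambda>s. (s, 0))) (at t)"
    by (intro has_derivative_Pair has_derivative_const has_derivative_ident)
  from has_derivative_compose[OF this assms[unfolded frechet_derivative_works]]
  have "((\<lambda>t. f (t, z)) has_derivative (\<lambda>s. frechet_derivative f (at (t, z)) (s *\<^sub>R (1, 0)))) (at t)"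
    by simp
  then have "((\<lambda>t. f (t, z)) has_vector_derivative frechet_derivative f (at (t, z)) (1, 0)) (at t)"
    unfolding has_vector_derivative_def
    by (simp only: linear_cmul[OF linear_frechet_derivative[OF assms]])
  then show ?thesis by (rule vector_derivative_at)
qed

lemma (in bounded_bilinear) frechet_derivative:
  assumes "f differentiable at x" "g differentiable at x"
  shows "frechet_derivative (\<lambda>x. prod (f x) (g x)) (at x) h =
    prod (f x) (frechet_derivative g (at x) h) + prod (frechet_derivative f (at x) h) (g x)"
  using assms unfolding frechet_derivative_works
  by (intro frechet_derivative_at[THEN fun_cong, symmetric] FDERIV)

lemma (in bounded_bilinear) frechet_derivative_const_on:
  assumes "open U" "x \<in> U" "\<And>y. y \<in> U \<Longrightarrow> prod (f y) (g y) = c"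
    and "f differentiable at x" "g differentiable at x"
  shows "prod (f x) (frechet_derivative g (at x) h) + prod (frechet_derivative f (at x) h) (g x) = 0"
  using frechet_derivative[OF assms(4,5), of h]
    frechet_derivative_cong_open[OF assms(1-3)] by simp

lemma smooth_on_differentiable:
  assumes "smooth_on f S" "x \<in> S"
  shows "f differentiable at x" "(\<lambda>x. frechet_derivative f (at x) v) differentiable at x"
proof -
  have "Ck_on (Suc (Suc 0)) f S" using assms(1) unfolding smooth_on_def ..
  then show "f differentiable at x" "(\<lambda>x. frechet_derivative f (at x) v) differentiable at x"
    using assms(2) by simp_all
qed

lemma smooth_on_frechet_derivative:
  assumes "smooth_on f S"
  shows "smooth_on (\<lambda>x. frechet_derivative f (at x) v) S"
  unfolding smooth_on_def
proof
  fix k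
  have "Ck_on (Suc k) f S" using assms unfolding smooth_on_def ..
  then show "Ck_on k (\<lambda>x. frechet_derivative f (at x) v) S" by simp
qed

lemma Ck_on_vec:
  fixes f :: "'a::real_normed_vector \<Rightarrow> real^'m::finite"
  assumes "open S" "\<And>i. Ck_on k (\<lambda>x. f x $ i) S"
  shows "Ck_on k f S"
proof -
  have "f = (\<lambda>x. \<Sum>i\<in>UNIV. f x $ i *\<^sub>R axis i 1)"
    by (simp add: basis_expansion flip: scalar_mult_eq_scaleR)
  moreover have "Ck_on k (\<lambda>x. \<Sum>i\<in>UNIV. f x $ i *\<^sub>R axis i (1::real)) S"
    by (rule Ck_on_sum[OF assms(1) Ck_on_scaleR[OF assms Ck_on_const]])
  ultimately show ?thesis by simp
qed

lemma Ck_on_det: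
  fixes A :: "'a::real_normed_vector \<Rightarrow> real^'m::finite^'m"
  assumes "open S" "\<And>i j. Ck_on k (\<lambda>x. A x $ i $ j) S"
  shows "Ck_on k (\<lambda>x. det (A x)) S"
  unfolding det_def
  by (rule Ck_on_sum[OF assms(1) Ck_on_mult[OF assms(1) Ck_on_const Ck_on_prod[OF assms]]])

section \<open>Linear algebra at a point of the hypersurface\<close>

lemma pinner_commute: "pinner P x y = pinner P y x"
  by (simp add: pinner_def mult.commute mult.left_commute)

lemma bounded_bilinear_pinner: "bounded_bilinear (pinner P)"
  unfolding bilinear_conv_bounded_bilinear[symmetric] bilinear_def linear_iff
  by (simp add: pinner_def algebra_simps sum.distrib sum_distrib_left)

lemma bounded_bilinear_wedge:
  "bounded_bilinear (wedge :: real^'m::finite \<Rightarrow> real^'m \<Rightarrow> real^'m^'m)"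
  unfolding bilinear_conv_bounded_bilinear[symmetric] bilinear_def linear_iff
  by (simp add: wedge_def vec_eq_iff algebra_simps)

lemma bounded_bilinear_bivector_inner: "bounded_bilinear (bivector_inner P)"
  unfolding bilinear_conv_bounded_bilinear[symmetric] bilinear_def linear_iff
  by (simp add: bivector_inner_def algebra_simps sum.distrib sum_distrib_left add_divide_distrib)

lemma bivector_inner_commute: "bivector_inner P A B = bivector_inner P B A"
  by (simp add: bivector_inner_def mult.commute mult.left_commute)

lemma wedge_commute: "wedge x y = - wedge y x"
  by (simp add: wedge_def vec_eq_iff)

lemma wedge_self: "wedge x x = 0"
  by (simp add: wedge_def vec_eq_iff)

lemmas pinner_bilinear =
  bounded_bilinear.add_left[OF bounded_bilinear_pinner]
  bounded_bilinear.add_right[OF bounded_bilinear_pinner]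
  bounded_bilinear.diff_left[OF bounded_bilinear_pinner]
  bounded_bilinear.diff_right[OF bounded_bilinear_pinner]
  bounded_bilinear.minus_left[OF bounded_bilinear_pinner]
  bounded_bilinear.minus_right[OF bounded_bilinear_pinner]
  bounded_bilinear.scaleR_left[OF bounded_bilinear_pinner]
  bounded_bilinear.scaleR_right[OF bounded_bilinear_pinner]
  bounded_bilinear.sum_right[OF bounded_bilinear_pinner]
  bounded_bilinear.zero_left[OF bounded_bilinear_pinner]
  bounded_bilinear.zero_right[OF bounded_bilinear_pinner]

lemmas wedge_bilinear =
  bounded_bilinear.add_left[OF bounded_bilinear_wedge]
  bounded_bilinear.add_right[OF bounded_bilinear_wedge]
  bounded_bilinear.diff_left[OF bounded_bilinear_wedge]
  bounded_bilinear.diff_right[OF bounded_bilinear_wedge]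
  bounded_bilinear.minus_left[OF bounded_bilinear_wedge]
  bounded_bilinear.minus_right[OF bounded_bilinear_wedge]
  bounded_bilinear.scaleR_left[OF bounded_bilinear_wedge]
  bounded_bilinear.scaleR_right[OF bounded_bilinear_wedge]

lemmas bivector_inner_bilinear =
  bounded_bilinear.add_left[OF bounded_bilinear_bivector_inner]
  bounded_bilinear.add_right[OF bounded_bilinear_bivector_inner]
  bounded_bilinear.diff_left[OF bounded_bilinear_bivector_inner]
  bounded_bilinear.diff_right[OF bounded_bilinear_bivector_inner]
  bounded_bilinear.scaleR_left[OF bounded_bilinear_bivector_inner]
  bounded_bilinear.scaleR_right[OF bounded_bilinear_bivector_inner]
  bounded_bilinear.zero_left[OF bounded_bilinear_bivector_inner]
  bounded_bilinear.zero_right[OF bounded_bilinear_bivector_inner]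

lemma pinner_axis: "pinner P x (axis i 1) = psign P i * x $ i"
  by (simp add: pinner_def axis_def if_distrib cong: if_cong)

lemma pinner_nondegenerate:
  assumes "\<And>y. pinner P x y = 0"
  shows "x = 0"
proof -
  have "psign P i \<noteq> 0" for i by (simp add: psign_def)
  with assms[of "axis _ 1"] show ?thesis by (simp add: pinner_axis vec_eq_iff)
qed

lemma sum_UNIV_option:
  "(\<Sum>k\<in>(UNIV :: 'n::finite option set). f k) = f None + (\<Sum>i\<in>UNIV. f (Some i))"
  by (simp add: UNIV_option_conv sum.reindex)

text \<open>The frame vectors are the rows of the matrix, so their coefficients solve a linear
  system with the transposed matrix, which is invertible.\<close>

lemma frame_matrix_span:
  assumes "det (frame_matrix x y e) \<noteq> 0"
  obtains a b c where "v = a *\<^sub>R x + b *\<^sub>R y + (\<Sum>i\<in>UNIV. c i *\<^sub>R e i)"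
proof -
  let ?M = "frame_matrix x y e"
  have "invertible (transpose ?M)" using assms by (simp add: invertible_det_nz)
  then obtain B where "transpose ?M ** B = mat 1" by (auto simp: invertible_def)
  then have "v = transpose ?M *v (B *v v)"
    by (simp add: matrix_vector_mul_assoc)
  also have "\<dots> = (\<Sum>k\<in>UNIV. (B *v v) $ k *\<^sub>R (?M $ k))"
    by (simp add: matrix_mult_sum scalar_mult_eq_scaleR row_def)
  also have "\<dots> = (B *v v) $ None *\<^sub>R x + (B *v v) $ Some None *\<^sub>R y
      + (\<Sum>i\<in>UNIV. (B *v v) $ Some (Some i) *\<^sub>R e i)"
    by (simp add: sum_UNIV_option frame_matrix_def)
  finally show thesis by (rule that)
qed

text \<open>Expand \<open>X\<close> in the frame; pairing with \<open>x\<close> and \<open>y\<close>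
  kills the first two coefficients. For a hypersurface, this says that the complement of the plane
  is the image of the differential.\<close>

lemma plane_orthogonal_subset_range:
  assumes "linear L" "det (frame_matrix x y (\<lambda>i. L (axis i 1))) \<noteq> 0"
    and "pinner P x x = 1" "pinner P x y = 0" "pinner P y y \<noteq> 0"
    and "\<And>v. pinner P x (L v) = 0" "\<And>v. pinner P y (L v) = 0"
    and "X \<in> plane_orthogonal P x y"
  shows "X \<in> range L"
proof -
  obtain a b c where X: "X = a *\<^sub>R x + b *\<^sub>R y + (\<Sum>i\<in>UNIV. c i *\<^sub>R L (axis i 1))"
    using frame_matrix_span[OF assms(2)] .
  then have X: "X = a *\<^sub>R x + b *\<^sub>R y + L (\<Sum>i\<in>UNIV. c i *\<^sub>R axis i 1)"
    by (simp add: linear_sum[OF assms(1)] linear_cmul[OF assms(1)])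
  have "pinner P x X = 0" "pinner P y X = 0"
    using assms(8) by (simp_all add: plane_orthogonal_def pinner_commute)
  then have "a = 0" "b = 0"
    using assms(3-7) by (simp_all add: X pinner_bilinear pinner_commute[of P y x])
  with X show ?thesis by simp
qed

text \<open>The generalised cross product of \<open>x\<close> and the vectors \<open>e\<close>. The
  factor \<open>psign P j\<close> raises an index, so that pairing by \<open>pinner P\<close> gives
  a determinant.\<close>

definition normal_direction ::
    "'n::finite option option set \<Rightarrow> real^('n option option) \<Rightarrow> ('n \<Rightarrow> real^('n option option))
      \<Rightarrow> real^('n option option)" where
  "normal_direction P x e = (\<chi> j. psign P j * det (frame_matrix x (axis j 1) e))"

lemma pinner_normal_direction: "pinner P (normal_direction P x e) w = det (frame_matrix x w e)"
proof -
  \<comment> \<open>The value 0 in row \<open>Some None\<close> is a placeholder that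
    \<open>w\<close> overwrites; this is the shape that the row linearity of \<open>det\<close>
    expects.\<close>
  define r where "r = (\<lambda>k. case k of None \<Rightarrow> x | Some k' \<Rightarrow> (case k' of None \<Rightarrow> 0 | Some i \<Rightarrow> e i))"
  have r: "frame_matrix x w e = (\<chi> k. if k = Some None then w else r k)" for w
    by (auto simp: frame_matrix_def r_def vec_eq_iff split: option.split)
  have lin: "linear (\<lambda>w. det (frame_matrix x w e))"
    unfolding linear_iff r scalar_mult_eq_scaleR[symmetric]
    by (simp add: det_row_add[where a = "\<lambda>_. _"] det_row_mul[where a = "\<lambda>_. _"])
  have "w = (\<Sum>j\<in>UNIV. w $ j *\<^sub>R axis j 1)"
    by (simp add: basis_expansion flip: scalar_mult_eq_scaleR)
  then have "det (frame_matrix x w e) = det (frame_matrix x (\<Sum>j\<in>UNIV. w $ j *\<^sub>R axis j 1) e)"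
    by simp
  also have "\<dots> = (\<Sum>j\<in>UNIV. w $ j * det (frame_matrix x (axis j 1) e))"
    by (simp add: linear_sum[OF lin] linear_cmul[OF lin])
  also have "\<dots> = pinner P (normal_direction P x e) w"
    unfolding pinner_def normal_direction_def by (intro sum.cong) (auto simp: psign_def)
  finally show ?thesis ..
qed

text \<open>The cross product \<open>c\<close> is orthogonal to \<open>x\<close> and all
  \<open>e i\<close> because of repeated rows, hence a multiple of \<open>y\<close>. The positive
  determinant fixes the factor, including its sign, so \<open>y\<close> is an explicit function of
  \<open>x\<close> and \<open>e\<close>.\<close>

lemma unit_normal_eq:
  assumes eps: "eps = 1 \<or> eps = -1"
    and x: "pinner P x y = 0" and y: "pinner P y y = eps"
    and e: "\<And>i. pinner P y (e i) = 0"
    and pos: "det (frame_matrix x y e) > 0"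
  defines "c \<equiv> normal_direction P x e"
  shows "eps * pinner P c c > 0"
    and "y = (eps * (eps * pinner P c c) powr (-1/2)) *\<^sub>R c"
proof -
  define d where "d = det (frame_matrix x y e)"
  have ee: "eps * eps = 1" and ede: "eps * d * eps = d" using eps by auto
  have c: "pinner P c w = det (frame_matrix x w e)" for w
    by (simp add: c_def pinner_normal_direction)
  have "pinner P c x = 0"
    unfolding c by (rule det_identical_rows[of None "Some None"])
      (simp_all add: row_def frame_matrix_def)
  moreover have "pinner P c (e i) = 0" for i
    unfolding c by (rule det_identical_rows[of "Some None" "Some (Some i)"])
      (simp_all add: row_def frame_matrix_def)
  moreover have "pinner P c y = d" by (simp add: c d_def)
  \<comment> \<open>Since \<open>y\<close> pairs with itself to \<open>eps\<close> and
    \<open>c\<close> pairs with \<open>y\<close> to \<open>d\<close>, the factor must be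
    \<open>eps * d\<close>.\<close>
  ultimately have r: "pinner P (c - (eps * d) *\<^sub>R y) x = 0" "pinner P (c - (eps * d) *\<^sub>R y) y = 0"
    "pinner P (c - (eps * d) *\<^sub>R y) (e i) = 0" for i
    using x y e by (simp_all add: pinner_bilinear pinner_commute[of P y x] ede)
  have "pinner P (c - (eps * d) *\<^sub>R y) w = 0" for w
  proof -
    obtain a b f where "w = a *\<^sub>R x + b *\<^sub>R y + (\<Sum>i\<in>UNIV. f i *\<^sub>R e i)"
      using frame_matrix_span[of x y e w] pos by auto
    then show ?thesis using r by (simp add: bounded_bilinear.add_right[OF bounded_bilinear_pinner]
        bounded_bilinear.sum_right[OF bounded_bilinear_pinner]
        bounded_bilinear.scaleR_right[OF bounded_bilinear_pinner])
  qed
  then have "c - (eps * d) *\<^sub>R y = 0" by (rule pinner_nondegenerate)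
  then have cy: "c = (eps * d) *\<^sub>R y" by simp
  have d: "d > 0" using pos by (simp add: d_def)
  have "eps * pinner P c c = (eps * eps) * (eps * eps) * d^2"
    by (simp add: cy pinner_bilinear y power2_eq_square)
  then have cc: "eps * pinner P c c = d^2" by (simp add: ee)
  with d show "eps * pinner P c c > 0" by simp
  have "(d^2) powr (-1/2) = 1 / d"
    using d by (simp add: powr_minus powr_half_sqrt divide_simps)
  then have "(eps * (eps * pinner P c c) powr (-1/2)) *\<^sub>R c = (eps * (1 / d)) *\<^sub>R c"
    by (simp only: cc)
  also have "\<dots> = y" using d ee by (subst cy) simp
  finally show "y = (eps * (eps * pinner P c c) powr (-1/2)) *\<^sub>R c" ..
qed

text \<open>In coordinates, \<open>v\<close> is sent to the functional \<open>B v\<close> by an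
  injective linear endomorphism of a finite-dimensional space, which is then surjective. This makes
  the description of the gradient well defined.\<close>

lemma nondegenerate_representation:
  fixes B :: "real^'n::finite \<Rightarrow> real^'n \<Rightarrow> real"
  assumes "bounded_bilinear B" "\<And>v. (\<And>w. B v w = 0) \<Longrightarrow> v = 0" "linear l"
  shows "\<exists>!v. \<forall>w. B v w = l w"
proof -
  interpret bounded_bilinear B by fact
  have B: "B v w = (\<Sum>i\<in>UNIV. w $ i * B v (axis i 1))" for v w
    by (subst (1) basis_expansion[of w, symmetric])
      (simp add: sum_right scalar_mult_eq_scaleR scaleR_right)
  have l: "l w = (\<Sum>i\<in>UNIV. w $ i * l (axis i 1))" for w
    by (subst (1) basis_expansion[of w, symmetric])
      (simp add: linear_sum[OF assms(3)] linear_cmul[OF assms(3)] scalar_mult_eq_scaleR)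
  let ?T = "\<lambda>v. \<chi> i. B v (axis i 1)"
  have T: "linear ?T" by (simp add: linear_iff vec_eq_iff add_left scaleR_left)
  have "inj ?T"
  proof (subst linear_injective_0[OF T], intro allI impI)
    fix v assume "?T v = 0"
    then have "B v (axis i 1) = 0" for i by (simp add: vec_eq_iff)
    then have "B v w = 0" for w by (simp only: B[of v w] mult_zero_right sum.neutral_const)
    then show "v = 0" by (rule assms(2))
  qed
  then have "surj ?T" by (rule linear_inj_imp_surj[OF T])
  from surjD[OF this, of "\<chi> i. l (axis i 1)"] obtain v where "(\<chi> i. l (axis i 1)) = ?T v" ..
  then have "B v (axis i 1) = l (axis i 1)" for i by (simp add: vec_eq_iff)
  then have v: "B v w = l w" for w by (simp only: B[of v w] l[of w])
  moreover have "v' = v" if "\<forall>w. B v' w = l w" for v'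
    using assms(2)[of "v' - v"] that v by (simp add: diff_left)
  ultimately show ?thesis by blast
qed

text \<open>Pure linear algebra at one point: \<open>x\<close> is the position, \<open>y\<close> the
  normal, \<open>L\<close> and \<open>S\<close> are the differentials of position and normal, and
  \<open>dG\<close> is that of the Gauss map. The assumption \<open>sym\<close> is the symmetry of
  the second fundamental form.\<close>

locale hypersurface_point =
  fixes P :: "'n::finite option option set" and eps :: real
    and x y :: "real^('n option option)" and L S :: "real^'n \<Rightarrow> real^('n option option)"
    and dG :: "real^'n \<Rightarrow> real^('n option option)^('n option option)"
  assumes eps: "eps = 1 \<or> eps = -1"
    and linear: "linear L" "linear S"
    and xy: "pinner P x x = 1" "pinner P x y = 0" "pinner P y y = eps"
    and orth: "\<And>v. pinner P x (L v) = 0" "\<And>v. pinner P y (L v) = 0"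
      "\<And>v. pinner P x (S v) = 0" "\<And>v. pinner P y (S v) = 0"
    and sym: "\<And>v w. pinner P (S v) (L w) = pinner P (S w) (L v)"
    and frame: "det (frame_matrix x y (\<lambda>i. L (axis i 1))) \<noteq> 0"
    and dG: "\<And>v. dG v = wedge (L v) y + wedge x (S v)"
    and nondegenerate: "\<And>v. (\<And>w. bivector_inner P (dG v) (dG w) = 0) \<Longrightarrow> v = 0"
begin

text \<open>The (para)complex structure applied to \<open>dG v\<close>, in closed form;
  \<open>JJ_dG\<close> links it to the definite description.\<close>

definition JdG :: "real^'n \<Rightarrow> real^('n option option)^('n option option)" where
  "JdG v = wedge y (S v) + eps *\<^sub>R wedge x (L v)"

lemma eps_sq: "eps * eps = 1"
  using eps by auto

lemma orth': "pinner P y x = 0" "pinner P (L v) x = 0" "pinner P (L v) y = 0"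
  "pinner P (S v) x = 0" "pinner P (S v) y = 0"
  using xy orth by (simp_all add: pinner_commute)

lemma plane_orthogonal: "L v \<in> plane_orthogonal P x y" "S v \<in> plane_orthogonal P x y"
  by (simp_all add: plane_orthogonal_def orth')

lemma JJ_dG: "JJ P eps (wedge x y) (dG v) = JdG v"
proof -
  \<comment> \<open>In the normal form of tangent vectors, \<open>dG v\<close> has
    \<open>X = S v\<close> and \<open>Y = - L v\<close>.\<close>
  have "- L v \<in> plane_orthogonal P x y"
    using plane_orthogonal[of v] by (simp add: plane_orthogonal_def pinner_bilinear)
  then have "JJ P eps (wedge x y) (wedge x (S v) + wedge y (- L v)) =
      wedge y (S v) - eps *\<^sub>R wedge x (- L v)"
    using xy eps plane_orthogonal
    by (intro JJ_wedge) (simp_all add: pseudosphere_def tangent_sphere_def)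
  then show ?thesis
    by (simp add: dG JdG_def wedge_bilinear wedge_commute[of "L v" y] algebra_simps)
qed

lemma linear_dG: "linear dG" and linear_JdG: "linear JdG"
  by (simp_all add: linear_iff dG JdG_def wedge_bilinear algebra_simps
      linear_add[OF linear(1)] linear_add[OF linear(2)] linear_cmul[OF linear(1)]
      linear_cmul[OF linear(2)])

text \<open>The pairing evaluates to
  \<open>eps * (pinner P (L v) (S w) - pinner P (L w) (S v))\<close>, so the Lagrangian condition is
  the symmetry of the second fundamental form.\<close>

lemma inner_JdG_dG: "bivector_inner P (JdG v) (dG w) = 0"
  using sym[of v w] pinner_commute[of P "L v" "S w"]
  by (simp add: JdG_def dG bivector_inner_bilinear bivector_inner_wedge xy orth orth'
      pinner_commute[of P "L w"])

lemma inner_JdG_JdG: "bivector_inner P (JdG v) (JdG w) = eps * bivector_inner P (dG v) (dG w)"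
  using eps
  by (auto simp: JdG_def dG bivector_inner_bilinear bivector_inner_wedge xy orth orth' algebra_simps)

text \<open>Both \<open>f\<close> and \<open>g\<close> start from a space of dimension 2n. The map
  \<open>g\<close> parametrises the whole tangent space, \<open>f\<close> is injective, and its
  range lies in that of \<open>g\<close>; hence the ranges agree.\<close>

lemma tangent_decomposition:
  assumes "X \<in> plane_orthogonal P x y" "Y \<in> plane_orthogonal P x y"
  obtains v w where "wedge x X + wedge y Y = dG v + JdG w"
proof -
  have L: "Z \<in> range L" if "Z \<in> plane_orthogonal P x y" for Z
    using eps by (intro plane_orthogonal_subset_range[OF linear(1) frame xy(1,2) _ orth(1,2) that])
      (auto simp: xy(3))
  define f where "f = (\<lambda>(v, w). dG v + JdG w)"
  define g where "g = (\<lambda>(v, w). wedge x (L v) + wedge y (L w))"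
  have f: "linear f"
    by (simp add: linear_iff f_def case_prod_beta linear_add[OF linear_dG] linear_add[OF linear_JdG]
        linear_cmul[OF linear_dG] linear_cmul[OF linear_JdG] algebra_simps)
  have g: "linear g"
    by (simp add: linear_iff g_def case_prod_beta wedge_bilinear linear_add[OF linear(1)]
        linear_cmul[OF linear(1)] algebra_simps)
  have "inj f"
  proof (subst linear_injective_0[OF f], intro allI impI)
    fix vw assume fvw: "f vw = 0"
    obtain v w where vw: "vw = (v, w)" by fastforce
    with fvw have 0: "dG v + JdG w = 0" by (simp add: f_def)
    \<comment> \<open>Pairing with \<open>dG u\<close> isolates \<open>v\<close>; once
      \<open>v = 0\<close>, compatibility of the metric with the structure isolates
      \<open>w\<close>.\<close>
    have "bivector_inner P (dG v + JdG w) (dG u) = bivector_inner P (dG v) (dG u)" for u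
      by (simp add: bivector_inner_bilinear inner_JdG_dG)
    then have v: "v = 0" using 0 by (intro nondegenerate) (simp add: bivector_inner_bilinear)
    then have "JdG w = 0" using 0 linear_0[OF linear_dG] by simp
    then have "eps * bivector_inner P (dG w) (dG u) = 0" for u
      using inner_JdG_JdG[of w u] by (simp add: bivector_inner_bilinear)
    then have "w = 0" using eps by (intro nondegenerate) auto
    with v vw show "vw = 0" by (simp add: zero_prod_def)
  qed
  have "range f \<subseteq> range g"
  proof
    fix Z assume "Z \<in> range f"
    then obtain v w where Z: "Z = dG v + JdG w" by (auto simp: f_def)
    obtain v' where v': "S v = L v'" using L[OF plane_orthogonal(2)] by blast
    obtain w' where w': "S w = L w'" using L[OF plane_orthogonal(2)] by blast
    have "Z = g (v' + eps *\<^sub>R w, w' - v)"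
      by (simp add: Z g_def dG JdG_def v' w' wedge_bilinear wedge_commute[of "L v" y] linear_add[OF linear(1)]
          linear_cmul[OF linear(1)] linear_diff[OF linear(1)] algebra_simps)
    then show "Z \<in> range g" by blast
  qed
  moreover have "dim (range f) \<ge> dim (range g)"
    using dim_image_eq[OF f, of UNIV] dim_image_le[OF g, of UNIV] \<open>inj f\<close> by simp
  ultimately have "range f = range g"
    using f g by (intro subspace_dim_equal linear_subspace_image) simp_all
  moreover obtain a where "X = L a" using L[OF assms(1)] by blast
  moreover obtain b where "Y = L b" using L[OF assms(2)] by blast
  ultimately have "wedge x X + wedge y Y \<in> range f"
    using rangeI[of g "(a, b)"] by (simp add: g_def)
  then show thesis using that by (auto simp: f_def)
qed

lemma variation_tangent:
  assumes "pinner P x x' = 0" "pinner P y y' = 0" "pinner P x' y + pinner P x y' = 0"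
  obtains v w where "wedge x' y + wedge x y' = dG v + JdG w"
proof -
  \<comment> \<open>The multiples of \<open>x\<close> and \<open>y\<close> make \<open>X\<close> and
    \<open>Y\<close> orthogonal to the plane and disappear in \<open>wedge x X\<close> and
    \<open>wedge y Y\<close>.\<close>
  define X where "X = y' - pinner P x y' *\<^sub>R x"
  define Y where "Y = (eps * pinner P x' y) *\<^sub>R y - x'"
  have "X \<in> plane_orthogonal P x y" "Y \<in> plane_orthogonal P x y"
    using assms eps_sq xy orth'
    by (simp_all add: X_def Y_def plane_orthogonal_def pinner_bilinear pinner_commute[of P y' x]
        pinner_commute[of P x' x] pinner_commute[of P y' y] mult.commute mult.left_commute)
  moreover have "wedge x X + wedge y Y = wedge x' y + wedge x y'"
    by (simp add: X_def Y_def wedge_bilinear wedge_self wedge_commute[of x' y])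
  ultimately show thesis using tangent_decomposition that by metis
qed

text \<open>Multiplied by \<open>eps\<close>, the left side is the symplectic form of
  \<open>dG v\<close> and the velocity; the bracket on the right will turn out to be
  \<open>du\<close>.\<close>

lemma inner_JdG_variation:
  assumes "pinner P x x' = 0" "pinner P y y' = 0"
  shows "bivector_inner P (JdG v) (wedge x' y + wedge x y') =
    eps * (pinner P y' (L v) - pinner P x' (S v))"
  using assms
  by (simp add: JdG_def bivector_inner_bilinear bivector_inner_wedge xy orth orth' algebra_simps
      pinner_commute)

text \<open>Splits the velocity as \<open>dG v + JdG w\<close>. Pairing with all
  \<open>JdG u\<close> shows that \<open>w\<close> represents the form \<open>l\<close>, and
  \<open>JdG w\<close> is the normal part.\<close>

lemma normal_component_variation:
  assumes "pinner P x x' = 0" "pinner P y y' = 0" "pinner P x' y + pinner P x y' = 0"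
    and l: "\<And>w. l w = pinner P y' (L w) - pinner P x' (S w)"
  shows "normal_component (bivector_inner P) (range dG) (wedge x' y + wedge x y') =
    JJ P eps (wedge x y) (dG (THE v. \<forall>w. bivector_inner P (dG v) (dG w) = l w))"
proof -
  let ?V = "wedge x' y + wedge x y'"
  interpret bivector: bounded_bilinear "bivector_inner P"
    by (rule bounded_bilinear_bivector_inner)
  have "linear l"
    by (simp add: linear_iff l pinner_bilinear linear_add[OF linear(1)] linear_add[OF linear(2)]
        linear_cmul[OF linear(1)] linear_cmul[OF linear(2)] algebra_simps)
  moreover have "bounded_bilinear (\<lambda>v w. bivector_inner P (dG v) (dG w))"
    using linear_dG by (intro bivector.comp) (simp_all add: linear_conv_bounded_linear)
  ultimately have "\<exists>!v. \<forall>w. bivector_inner P (dG v) (dG w) = l w"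
    using nondegenerate by (intro nondegenerate_representation) auto
  from theI'[OF this] obtain g where g: "g = (THE v. \<forall>w. bivector_inner P (dG v) (dG w) = l w)"
    "\<And>w. bivector_inner P (dG g) (dG w) = l w" by blast
  obtain v w where V: "?V = dG v + JdG w" using variation_tangent[OF assms(1-3)] .
  have "w = g"
  proof -
    have "bivector_inner P (dG (w - g)) (dG u) = 0" for u
    proof -
      \<comment> \<open>The tangential part \<open>dG v\<close> is invisible to
        \<open>JdG u\<close>.\<close>
      have "eps * bivector_inner P (dG w) (dG u) = bivector_inner P (JdG u) ?V"
        using inner_JdG_JdG[of u w]
        by (simp add: V bivector.add_right inner_JdG_dG bivector_inner_commute[of P "dG w"])
      also have "\<dots> = eps * bivector_inner P (dG g) (dG u)"
        using inner_JdG_variation[OF assms(1,2)] by (simp add: l g(2))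
      finally show ?thesis
        using eps by (auto simp: linear_diff[OF linear_dG] bivector.diff_left)
    qed
    then have "w - g = 0" by (rule nondegenerate)
    then show ?thesis by simp
  qed
  moreover have "normal_component (bivector_inner P) (range dG) ?V = JdG w"
    unfolding normal_component_def
  proof (rule the_equality)
    show "?V - JdG w \<in> range dG \<and> (\<forall>Z\<in>range dG. bivector_inner P (JdG w) Z = 0)"
      by (auto simp: V inner_JdG_dG)
    \<comment> \<open>Two candidates differ by a tangential vector orthogonal to all tangential
      vectors, which vanishes by nondegeneracy.\<close>
    fix W assume W: "?V - W \<in> range dG \<and> (\<forall>Z\<in>range dG. bivector_inner P W Z = 0)"
    then obtain a where "dG v + JdG w - W = dG a" unfolding V by blast
    then have a: "W - JdG w = dG (v - a)" by (simp add: linear_diff[OF linear_dG] algebra_simps)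
    have "bivector_inner P (dG (v - a)) (dG u) = 0" for u
      using W by (simp add: a[symmetric] bivector.diff_left inner_JdG_dG)
    then have "v - a = 0" by (rule nondegenerate)
    with a show "W = JdG w" by (simp add: linear_0[OF linear_dG])
  qed
  ultimately show ?thesis by (simp add: JJ_dG g(1))
qed

lemma Omega_dG: "Omega P eps (wedge x y) (dG v) (dG w) = 0"
  by (simp add: Omega_def JJ_dG inner_JdG_dG)

end

section \<open>One-parameter families with unit normal\<close>

text \<open>The family in one chart, with time and position joined into \<open>p = (t, z)\<close>:
  directions \<open>(0, v)\<close> are spatial and \<open>(1, 0)\<close> is time. \<open>F\<close>
  is the position and \<open>M\<close> the unit normal.\<close>

locale normal_family =
  fixes P :: "'n::finite option option set" and eps :: real and I :: "real set" and D :: "(real^'n) set"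
    and F M :: "real \<times> (real^'n) \<Rightarrow> real^('n option option)"
  assumes eps: "eps = 1 \<or> eps = -1"
    and opens: "open I" "open D"
    and smooth_F: "smooth_on F (I \<times> D)"
    and unit: "\<And>p. p \<in> I \<times> D \<Longrightarrow> pinner P (F p) (F p) = 1"
      "\<And>p. p \<in> I \<times> D \<Longrightarrow> pinner P (F p) (M p) = 0"
      "\<And>p. p \<in> I \<times> D \<Longrightarrow> pinner P (M p) (M p) = eps"
    and normal: "\<And>p v. p \<in> I \<times> D \<Longrightarrow> pinner P (M p) (frechet_derivative F (at p) (0, v)) = 0"
    and positive: "\<And>p. p \<in> I \<times> D \<Longrightarrow>
      det (frame_matrix (F p) (M p) (\<lambda>i. frechet_derivative F (at p) (0, axis i 1))) > 0"
begin

abbreviation "dF p \<equiv> frechet_derivative F (at p)"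
abbreviation "dM p \<equiv> frechet_derivative M (at p)"

definition W :: "real \<times> (real^'n) \<Rightarrow> real^('n option option)^('n option option)" where
  "W p = wedge (F p) (M p)"

lemma open_domain: "open (I \<times> D)"
  by (intro open_Times opens)

lemma smooth_M: "smooth_on M (I \<times> D)"
proof -
  define c where "c p = normal_direction P (F p) (\<lambda>i. dF p (0, axis i 1))" for p
  have c: "eps * pinner P (c p) (c p) > 0"
    "M p = (eps * (eps * pinner P (c p) (c p)) powr (-1/2)) *\<^sub>R c p" if "p \<in> I \<times> D" for p
    using unit_normal_eq[OF eps unit(2)[OF that] unit(3)[OF that] normal[OF that] positive[OF that]]
    unfolding c_def by blast+
  have "Ck_on k M (I \<times> D)" for k
  proof -
    have F: "Ck_on k F (I \<times> D)" "Ck_on k (\<lambda>p. dF p v) (I \<times> D)" for v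
      using smooth_F smooth_on_frechet_derivative[OF smooth_F] by (auto simp: smooth_on_def)
    have comp: "Ck_on k (\<lambda>p. f p $ l) (I \<times> D)" if "Ck_on k f (I \<times> D)"
      for f :: "real \<times> (real^'n) \<Rightarrow> real^('n option option)" and l
      by (rule bounded_linear.Ck_on[OF bounded_linear_vec_nth open_domain that])
    have entry: "Ck_on k (\<lambda>p. frame_matrix (F p) (axis j 1) (\<lambda>i. dF p (0, axis i 1)) $ r $ l) (I \<times> D)"
      for j r l
      \<comment> \<open>The nested case split separates the row \<open>F p\<close>, the constant row
        \<open>axis j 1\<close> and the rows of partial derivatives.\<close>
      by (cases r rule: option.exhaust[case_product option.exhaust[of "the r"]])
        (simp_all add: frame_matrix_def comp F Ck_on_const)
    have C: "Ck_on k c (I \<times> D)"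
    proof (rule Ck_on_vec[OF open_domain])
      fix j
      show "Ck_on k (\<lambda>p. c p $ j) (I \<times> D)"
        unfolding c_def normal_direction_def vec_lambda_beta
        by (rule Ck_on_mult[OF open_domain Ck_on_const Ck_on_det[OF open_domain entry]])
    qed
    have "Ck_on k (\<lambda>p. eps * pinner P (c p) (c p)) (I \<times> D)"
      by (rule Ck_on_mult[OF open_domain Ck_on_const
            bounded_bilinear.Ck_on[OF bounded_bilinear_pinner open_domain C C]])
    then have "Ck_on k (\<lambda>p. (eps * (eps * pinner P (c p) (c p)) powr (-1/2)) *\<^sub>R c p) (I \<times> D)"
      by (rule Ck_on_scaleR[OF open_domain Ck_on_mult[OF open_domain Ck_on_const
              Ck_on_powr[OF open_domain _ c(1)]] C])
    then show ?thesis by (simp only: Ck_on_cong[OF open_domain c(2)])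
  qed
  then show ?thesis by (simp add: smooth_on_def)
qed

lemma smooth_W: "smooth_on W (I \<times> D)"
  using smooth_F smooth_M
  by (simp add: smooth_on_def W_def[abs_def] bounded_bilinear.Ck_on[OF bounded_bilinear_wedge open_domain])

context
  fixes p assumes p: "p \<in> I \<times> D"
begin

lemmas differentiable_F = smooth_on_differentiable[OF smooth_F p]
lemmas differentiable_M = smooth_on_differentiable[OF smooth_M p]

lemma deriv_W:
  "frechet_derivative W (at p) h = wedge (dF p h) (M p) + wedge (F p) (dM p h)"
  unfolding W_def[abs_def]
  using bounded_bilinear.frechet_derivative[OF bounded_bilinear_wedge differentiable_F(1) differentiable_M(1)]
  by simp

text \<open>All four differentiate the constant products in \<open>unit\<close> and
  \<open>normal\<close>. The last one serves twice: spatial \<open>h\<close> yields the symmetry of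
  the second fundamental form, and \<open>h = (1, 0)\<close> yields the differential of the normal
  speed.\<close>

lemma deriv_unit:
  "pinner P (F p) (dF p h) = 0"
  "pinner P (M p) (dM p h) = 0"
  "pinner P (dF p h) (M p) + pinner P (F p) (dM p h) = 0"
  "pinner P (dM p h) (dF p (0, v)) =
    - pinner P (M p) (frechet_derivative (\<lambda>p. dF p (0, v)) (at p) h)"
proof -
  note const = bounded_bilinear.frechet_derivative_const_on[OF bounded_bilinear_pinner open_domain p]
  show "pinner P (F p) (dF p h) = 0"
    using const[OF unit(1) differentiable_F(1) differentiable_F(1), of h]
    by (simp add: pinner_commute)
  show "pinner P (M p) (dM p h) = 0"
    using const[OF unit(3) differentiable_M(1) differentiable_M(1), of h]
    by (simp add: pinner_commute)
  show "pinner P (dF p h) (M p) + pinner P (F p) (dM p h) = 0"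
    using const[OF unit(2) differentiable_F(1) differentiable_M(1), of h] by simp
  show "pinner P (dM p h) (dF p (0, v)) =
      - pinner P (M p) (frechet_derivative (\<lambda>p. dF p (0, v)) (at p) h)"
    using const[OF normal[of _ v] differentiable_M(1) differentiable_F(2), of h] by linarith
qed

lemma symmetric_F:
  "frechet_derivative (\<lambda>p. dF p h) (at p) k = frechet_derivative (\<lambda>p. dF p k) (at p) h"
  using smooth_F by (intro second_derivative_symmetric[OF open_domain _ p]) (simp add: smooth_on_def)

lemma hypersurface_point:
  assumes "\<And>v. (\<And>w. bivector_inner P (frechet_derivative W (at p) (0, v))
      (frechet_derivative W (at p) (0, w)) = 0) \<Longrightarrow> v = 0"
  shows "hypersurface_point P eps (F p) (M p) (\<lambda>v. dF p (0, v)) (\<lambda>v. dM p (0, v))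
    (\<lambda>v. frechet_derivative W (at p) (0, v))"
proof (rule hypersurface_point.intro)
  have "linear (\<lambda>v. (0, v) :: real \<times> (real^'n))" by (simp add: linear_iff)
  note lin = linear_compose[OF this, unfolded o_def]
  show "linear (\<lambda>v. dF p (0, v))" "linear (\<lambda>v. dM p (0, v))"
    using differentiable_F(1) differentiable_M(1) by (simp_all add: lin linear_frechet_derivative)
  show "pinner P (F p) (dM p (0, v)) = 0" for v
    using deriv_unit(3)[of "(0, v)"] normal[OF p, of v] by (simp add: pinner_commute)
  \<comment> \<open>Moving the derivative from the normal to \<open>dF\<close> leaves second
    derivatives of \<open>F\<close>, which are symmetric.\<close>
  show "pinner P (dM p (0, v)) (dF p (0, w)) = pinner P (dM p (0, w)) (dF p (0, v))" for v w
    using deriv_unit(4) symmetric_F by simp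
  show "det (frame_matrix (F p) (M p) (\<lambda>i. dF p (0, axis i 1))) \<noteq> 0"
    using positive[OF p] by simp
qed (use eps unit[OF p] normal[OF p] deriv_unit deriv_W assms in auto)

text \<open>The product rule leaves a second derivative of \<open>F\<close> in time and space;
  exchanging the order lets the time derivative of the orthogonality relation replace it.\<close>

lemma deriv_speed:
  "frechet_derivative (\<lambda>p. - pinner P (dF p (1, 0)) (M p)) (at p) (0, w) =
    pinner P (dM p (1, 0)) (dF p (0, w)) - pinner P (dF p (1, 0)) (dM p (0, w))"
proof -
  have "frechet_derivative (\<lambda>p. pinner P (- dF p (1, 0)) (M p)) (at p) (0, w) =
      pinner P (- dF p (1, 0)) (dM p (0, w)) +
      pinner P (frechet_derivative (\<lambda>p. - dF p (1, 0)) (at p) (0, w)) (M p)"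
    using differentiable_F(2) differentiable_M(1)
    by (intro bounded_bilinear.frechet_derivative[OF bounded_bilinear_pinner]) simp_all
  moreover have "frechet_derivative (\<lambda>p. - dF p (1, 0)) (at p) (0, w) =
      - frechet_derivative (\<lambda>p. dF p (1, 0)) (at p) (0, w)"
    using differentiable_F(2)
    by (rule bounded_linear.frechet_derivative[OF bounded_linear_minus[OF bounded_linear_ident]])
  ultimately show ?thesis
    using deriv_unit(4)[of "(1, 0)" w] symmetric_F[of "(0, w)" "(1, 0)"]
    by (simp add: pinner_bilinear pinner_commute[of P _ "M p"])
qed

end

end

theorem theorem1p1:
  fixes A :: "('a::{t2_space, second_countable_topology}, 'n::finite) atlas"
    and P :: "'n option option set"
    and eps t0 :: real
    and \<phi> N :: "real \<Rightarrow> 'a \<Rightarrow> real^('n option option)"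
  assumes "oriented_manifold A"
    and "eps = 1 \<or> eps = -1"
    and "t0 > 0"
    and "smooth_family A t0 \<phi>"
    and "\<And>t. t \<in> {-t0<..<t0} \<Longrightarrow> \<phi> t ` carrier_of A \<subseteq> pseudosphere P"
    and "\<And>t. t \<in> {-t0<..<t0} \<Longrightarrow> immersion A (\<phi> t)"
    and "\<And>t. t \<in> {-t0<..<t0} \<Longrightarrow> nondegenerate_metric A (pinner P) (\<phi> t)"
    and "\<And>t. t \<in> {-t0<..<t0} \<Longrightarrow> unit_normal A P eps (\<phi> t) (N t)"
    and "immersion A (gauss_map (\<phi> 0) (N 0))"
    and "nondegenerate_metric A (bivector_inner P) (gauss_map (\<phi> 0) (N 0))"
  shows "(\<exists>u. hamiltonian_variation_by A (oriented_geodesics P eps)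
            (bivector_inner P) (JJ P eps) (Omega P eps) t0 (\<lambda>t. gauss_map (\<phi> t) (N t)) u) \<and>
         (compactly_supported (carrier_of A) (velocity \<phi>) \<longrightarrow>
          hamiltonian_variation A (oriented_geodesics P eps)
            (bivector_inner P) (JJ P eps) (Omega P eps) t0 (\<lambda>t. gauss_map (\<phi> t) (N t)))"
proof -
  let ?I = "{-t0<..<t0}"
  let ?G = "\<lambda>t. gauss_map (\<phi> t) (N t)"
  define F where "F q = (\<lambda>(t, z). \<phi> t (q z))" for q :: "real^'n \<Rightarrow> 'a"
  define M where "M q = (\<lambda>(t, z). N t (q z))" for q :: "real^'n \<Rightarrow> 'a"
  \<comment> \<open>The negative of the pairing of velocity and normal, defined on the manifold
    itself, so no agreement between charts has to be checked.\<close>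
  define u where "u x = - pinner P (velocity \<phi> x) (N 0 x)" for x
  have zero: "0 \<in> ?I" using assms(3) by simp
  have smooth_F: "smooth_on (F q) (?I \<times> D)" if "(D, q) \<in> A" for D q
    using assms(4) that unfolding smooth_family_def F_def by blast
  have dF: "dmap (\<phi> t) q z v = frechet_derivative (F q) (at (t, z)) (0, v)"
    if "(D, q) \<in> A" "t \<in> ?I" "z \<in> D" for D q t z v
  proof -
    have "\<phi> t \<circ> q = (\<lambda>z. F q (t, z))" by (simp add: fun_eq_iff F_def)
    then show ?thesis
      using frechet_derivative_slice[OF smooth_on_differentiable(1)[OF smooth_F[OF that(1)]], of t z v] that
      by (simp add: dmap_def)
  qed
  have family: "normal_family P eps ?I D (F q) (M q)" if Dq: "(D, q) \<in> A" for D q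
  proof
    show "open D" using assms(1) Dq unfolding oriented_manifold_def by blast
    fix p assume "p \<in> ?I \<times> D"
    then obtain t z where p: "p = (t, z)" "t \<in> ?I" "z \<in> D" by blast
    have "q z \<in> carrier_of A" using Dq p(3) unfolding carrier_of_def by blast
    then have "\<phi> t (q z) \<in> pseudosphere P" using assms(5)[OF p(2)] by blast
    then show "pinner P (F q p) (F q p) = 1" by (simp add: p F_def pseudosphere_def)
    have N: "N t (q z) \<in> tangent_sphere P (\<phi> t (q z))" "pinner P (N t (q z)) (N t (q z)) = eps"
      "pinner P (N t (q z)) (dmap (\<phi> t) q z v) = 0"
      "det (frame_matrix (\<phi> t (q z)) (N t (q z)) (\<lambda>i. dmap (\<phi> t) q z (axis i 1))) > 0" for v
      using assms(8)[OF p(2)] Dq p(3) unfolding unit_normal_def by blast+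
    then show "pinner P (F q p) (M q p) = 0" "pinner P (M q p) (M q p) = eps"
      by (simp_all add: p F_def M_def tangent_sphere_def)
    show "pinner P (M q p) (frechet_derivative (F q) (at p) (0, v)) = 0" for v
      using N(3) by (simp add: p(1) M_def flip: dF[OF Dq p(2,3)])
    show "0 < det (frame_matrix (F q p) (M q p)
        (\<lambda>i. frechet_derivative (F q) (at p) (0, axis i 1)))"
      using N(4) by (simp add: p(1) M_def flip: dF[OF Dq p(2,3)]) (simp add: F_def)
  qed (use assms(2) smooth_F[OF Dq] in auto)
  have G: "?G t (q z) = normal_family.W (F q) (M q) (t, z)" if "(D, q) \<in> A" for D q t z
    unfolding normal_family.W_def[OF family[OF that]] by (simp add: gauss_map_def F_def M_def)
  have diff_W: "normal_family.W (F q) (M q) differentiable at (0, z)" if "(D, q) \<in> A" "z \<in> D" for D q z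
    using smooth_on_differentiable(1)[OF normal_family.smooth_W[OF family[OF that(1)]]] zero that(2)
    by simp
  have dG: "dmap (?G 0) q z v = frechet_derivative (normal_family.W (F q) (M q)) (at (0, z)) (0, v)"
    if "(D, q) \<in> A" "z \<in> D" for D q z v
  proof -
    have "?G 0 \<circ> q = (\<lambda>z. normal_family.W (F q) (M q) (0, z))" by (simp add: fun_eq_iff G[OF that(1)])
    then show ?thesis using frechet_derivative_slice[OF diff_W[OF that]] by (simp add: dmap_def)
  qed
  have point: "hypersurface_point P eps (F q (0, z)) (M q (0, z))
      (\<lambda>v. frechet_derivative (F q) (at (0, z)) (0, v)) (\<lambda>v. frechet_derivative (M q) (at (0, z)) (0, v))
      (dmap (?G 0) q z)" if Dq: "(D, q) \<in> A" and z: "z \<in> D" for D q z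
  proof -
    have "v = 0" if "\<And>w. bivector_inner P (dmap (?G 0) q z v) (dmap (?G 0) q z w) = 0" for v
      using assms(10) Dq z that unfolding nondegenerate_metric_def by blast
    then have "hypersurface_point P eps (F q (0, z)) (M q (0, z))
      (\<lambda>v. frechet_derivative (F q) (at (0, z)) (0, v)) (\<lambda>v. frechet_derivative (M q) (at (0, z)) (0, v))
      (\<lambda>v. frechet_derivative (normal_family.W (F q) (M q)) (at (0, z)) (0, v))"
      using zero z by (intro normal_family.hypersurface_point[OF family[OF Dq]])
        (simp_all add: dG[OF Dq z])
    then show ?thesis by (simp add: dG[OF Dq z, abs_def])
  qed
  have geodesics: "?G t ` carrier_of A \<subseteq> oriented_geodesics P eps" if t: "t \<in> ?I" for t
  proof
    fix l assume "l \<in> ?G t ` carrier_of A"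
    then obtain D q z where z: "(D, q) \<in> A" "z \<in> D" "l = ?G t (q z)"
      unfolding carrier_of_def by blast
    with t have "(t, z) \<in> ?I \<times> D" by simp
    note unit = normal_family.unit[OF family[OF z(1)] this]
    have "l = wedge (F q (t, z)) (M q (t, z))" by (simp add: z(3) gauss_map_def F_def M_def)
    with unit show "l \<in> oriented_geodesics P eps"
      unfolding oriented_geodesics_def pseudosphere_def tangent_sphere_def by blast
  qed
  have velocity_\<phi>: "velocity \<phi> (q z) = frechet_derivative (F q) (at (0, z)) (1, 0)"
    if "(D, q) \<in> A" "z \<in> D" for D q z
    using vector_derivative_slice[OF smooth_on_differentiable(1)[OF smooth_F[OF that(1)]], of 0 z] zero that(2)
    by (simp add: velocity_def F_def)
  have velocity_G: "velocity ?G (q z) =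
      frechet_derivative (normal_family.W (F q) (M q)) (at (0, z)) (1, 0)"
    if "(D, q) \<in> A" "z \<in> D" for D q z
    using vector_derivative_slice[OF diff_W[OF that]] by (simp add: velocity_def G[OF that(1)])
  \<comment> \<open>Extends \<open>u \<circ> q\<close> from time 0 to the whole time interval, so
    that the calculus of the joint variable applies.\<close>
  define s where "s q p = - pinner P (frechet_derivative (F q) (at p) (1, 0)) (M q p)" for q p
  have u: "(u \<circ> q) z = s q (0, z)" if "(D, q) \<in> A" "z \<in> D" for D q z
    by (simp add: u_def s_def velocity_\<phi>[OF that] M_def)
  have smooth_s: "Ck_on k (s q) (?I \<times> D)" if Dq: "(D, q) \<in> A" for D q k
  proof -
    note opn = normal_family.open_domain[OF family[OF Dq]]
    have "Ck_on k (\<lambda>p. pinner P (frechet_derivative (F q) (at p) (1, 0)) (M q p)) (?I \<times> D)"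
      using smooth_on_frechet_derivative[OF smooth_F[OF Dq]] normal_family.smooth_M[OF family[OF Dq]]
      by (intro bounded_bilinear.Ck_on[OF bounded_bilinear_pinner opn]) (simp_all add: smooth_on_def)
    from bounded_linear.Ck_on[OF bounded_linear_minus[OF bounded_linear_ident] opn this]
    show ?thesis by (simp add: s_def[abs_def])
  qed
  have open_D: "open D" if "(D, q) \<in> A" for D q
    using normal_family.opens(2)[OF family[OF that]] .
  have smooth_u: "smooth_map A u"
    unfolding smooth_map_def smooth_on_def
  proof (intro ballI, clarify)
    fix D q k assume Dq: "(D, q) \<in> A"
    have "Ck_on k (\<lambda>z. s q (0, z)) D"
      by (rule Ck_on_Pair_slice[OF open_D[OF Dq] smooth_s[OF Dq] zero])
    then show "Ck_on k (u \<circ> q) D" by (simp only: Ck_on_cong[OF open_D[OF Dq] u[OF Dq]])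
  qed
  have du: "dmap u q z w =
      pinner P (frechet_derivative (M q) (at (0, z)) (1, 0)) (frechet_derivative (F q) (at (0, z)) (0, w)) -
      pinner P (frechet_derivative (F q) (at (0, z)) (1, 0)) (frechet_derivative (M q) (at (0, z)) (0, w))"
    if Dq: "(D, q) \<in> A" and z: "z \<in> D" for D q z w
  proof -
    have p: "(0, z) \<in> ?I \<times> D" using zero z by simp
    have "dmap u q z w = frechet_derivative (\<lambda>z. s q (0, z)) (at z) w"
      unfolding dmap_def
      by (rule fun_cong[OF frechet_derivative_cong_open[OF open_D[OF Dq] z u[OF Dq]]])
    also have "\<dots> = frechet_derivative (s q) (at (0, z)) (0, w)"
      using smooth_s[OF Dq, of "Suc 0"] p by (intro frechet_derivative_slice) simp
    finally show ?thesis
      unfolding s_def[abs_def] normal_family.deriv_speed[OF family[OF Dq] p] .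
  qed
  have lagrangian: "lagrangian_immersion A (oriented_geodesics P eps) (bivector_inner P) (Omega P eps) (?G 0)"
    unfolding lagrangian_immersion_def
  proof (intro conjI assms(9,10) geodesics[OF zero] ballI, clarify)
    fix D q z v w assume Dq: "(D, q) \<in> A" and z: "z \<in> D"
    show "Omega P eps (?G 0 (q z)) (dmap (?G 0) q z v) (dmap (?G 0) q z w) = 0"
      using hypersurface_point.Omega_dG[OF point[OF Dq z]] by (simp add: gauss_map_def F_def M_def)
  qed
  have normal: "normal_component (bivector_inner P) (range (dmap (?G 0) q z)) (velocity ?G (q z)) =
      JJ P eps (?G 0 (q z)) (dmap (?G 0) q z (gradient (bivector_inner P) (?G 0) q u z))"
    if Dq: "(D, q) \<in> A" and z: "z \<in> D" for D q z
  proof -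
    have p: "(0, z) \<in> ?I \<times> D" using zero z by simp
    have "?G 0 (q z) = wedge (F q (0, z)) (M q (0, z))"
      by (simp add: gauss_map_def F_def M_def)
    \<comment> \<open>With \<open>l\<close> the differential of \<open>u\<close>, the vector
      described in \<open>normal_component_variation\<close> is exactly
      \<open>gradient\<close>.\<close>
    then show ?thesis
      unfolding gradient_def velocity_G[OF Dq z] normal_family.deriv_W[OF family[OF Dq] p]
      using hypersurface_point.normal_component_variation[OF point[OF Dq z]
          normal_family.deriv_unit(1-3)[OF family[OF Dq] p] du[OF Dq z]] by simp
  qed
  have "smooth_family A t0 ?G"
    unfolding smooth_family_def
  proof (intro ballI, clarify)
    fix D q assume Dq: "(D, q) \<in> A"
    have "(\<lambda>(t, z). ?G t (q z)) = normal_family.W (F q) (M q)"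
      by (simp add: fun_eq_iff G[OF Dq])
    with normal_family.smooth_W[OF family[OF Dq]]
    show "smooth_on (\<lambda>(t, z). ?G t (q z)) (?I \<times> D)" by simp
  qed
  then have variation: "hamiltonian_variation_by A (oriented_geodesics P eps) (bivector_inner P)
      (JJ P eps) (Omega P eps) t0 ?G u"
    unfolding hamiltonian_variation_by_def using lagrangian geodesics smooth_u normal by blast
  \<comment> \<open>Since \<open>u\<close> is linear in the velocity, it vanishes outside the same
    compact set.\<close>
  moreover have "compactly_supported (carrier_of A) u"
    if "compactly_supported (carrier_of A) (velocity \<phi>)"
    using that unfolding compactly_supported_def by (auto simp: u_def pinner_bilinear)
  ultimately show ?thesis unfolding hamiltonian_variation_def by blast
qed

end
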